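(* Let $G$ be a finite group, let $p$ be an odd prime, let $\chi\in\mathrm{Irr}(G)$ with $p\nmid\chi(1)$ and let $f=f_\chi$ be the conductor of $\chi$. Assume that $f_p\geq p^2$. Then Property 1.3 (as defined in the context) holds for $G$, $\chi$ and $p$ if and only if there is some $p$-element $g\in G$ with $(f_\chi)_p=(f_{\chi(g)})_p$.
   Context: $\mathrm{Irr}(G)$ is the set of irreducible complex characters of $G$. $\mathbb{Q}_n$ denotes the $n$-th cyclotomic field. For a character $\chi$ of $G$, $\mathbb{Q}(\chi)$ is the field generated over $\mathbb{Q}$ by the values of $\chi$, and its conductor $f_\chi$ is the smallest positive integer $f$ with $\mathbb{Q}(\chi)\subseteq\mathbb{Q}_f$. For $c\in\mathbb{C}$ with $\mathbb{Q}(c)/\mathbb{Q}$ abelian, $f_c$ is the smallest positive integer $f$ with $\mathbb{Q}(c)\subseteq\mathbb{Q}_f$. For a positive integer $n$, $n_p$ is the largest power of $p$ dividing $n$. A $p$-element is an element whose order is a power of $p$ (including the identity). Property 1.3 for a finite group $G$, an odd prime $p$ and $\chi\in\mathrm{Irr}(G)$ with $p\nmid\chi(1)$: writing the conductor of $\chi$ as $p^am$ with $a\ge0$ and $p\nmid m$, there exists a $p$-element $g\in G$ such that $p$ does not divide $[\mathbb{Q}_{p^a}:\mathbb{Q}(\chi(g))]$ (note that $\mathbb{Q}(\chi(g))\subseteq\mathbb{Q}_{p^a}$ for $p$-elements $g$). *)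

theory Defs
  imports
    "HOL-Computational_Algebra.Primes"
    "HOL-Algebra.Algebra"
    "HOL-Algebra.Algebraic_Closure_Type"
    "Jordan_Normal_Form.VS_Connect"
begin

definition representation :: "('a, 'b) monoid_scheme \<Rightarrow> nat \<Rightarrow> ('a \<Rightarrow> complex mat) \<Rightarrow> bool"
  where "representation G n \<rho> \<longleftrightarrow> \<rho> \<in> hom G (units_of (ring_mat TYPE(complex) n ()))"

definition irreducible_representation ::
    "('a, 'b) monoid_scheme \<Rightarrow> nat \<Rightarrow> ('a \<Rightarrow> complex mat) \<Rightarrow> bool"
  where "irreducible_representation G n \<rho> \<longleftrightarrow>
    representation G n \<rho> \<and> 0 < n \<and>
    (\<forall>W. subspace class_ring W (module_vec TYPE(complex) n) \<and>
         (\<forall>g\<in>carrier G. \<forall>w\<in>W. \<rho> g *\<^sub>v w \<in> W) \<longrightarrow>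
         W = {0\<^sub>v n} \<or> W = carrier_vec n)"

definition mat_trace :: "complex mat \<Rightarrow> complex"
  where "mat_trace A = (\<Sum>i<dim_row A. A $$ (i, i))"

text \<open>Characters are functions on the carrier; outside it they are \<^const>\<open>undefined\<close>.\<close>

definition irreducible_characters :: "('a, 'b) monoid_scheme \<Rightarrow> ('a \<Rightarrow> complex) set"
  where "irreducible_characters G =
    {restrict (\<lambda>g. mat_trace (\<rho> g)) (carrier G) | n \<rho>. irreducible_representation G n \<rho>}"

abbreviation complex_field :: "complex ring"
  where "complex_field \<equiv> ring_of_type_algebra"

text \<open>A subfield of \<open>\<complex>\<close> contains \<open>\<rat>\<close>, so \<open>generate_field complex_field S\<close> is \<open>\<rat>(S)\<close>.\<close>

abbreviation rat_adjoin :: "complex set \<Rightarrow> complex set"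
  where "rat_adjoin S \<equiv> generate_field complex_field S"

definition cyclotomic_field :: "nat \<Rightarrow> complex set"
  where "cyclotomic_field n = rat_adjoin {cis (2 * pi / real n)}"

definition character_field :: "('a, 'b) monoid_scheme \<Rightarrow> ('a \<Rightarrow> complex) \<Rightarrow> complex set"
  where "character_field G \<chi> = rat_adjoin (\<chi> ` carrier G)"

text \<open>\<open>ring.dim R K L\<close> is the dimension of \<open>L\<close> over \<open>K\<close>, so this is \<open>[L : K]\<close>. It is
  meaningful only if \<open>K \<subseteq> L\<close> are fields and \<open>L\<close> is finite-dimensional over \<open>K\<close>.\<close>

abbreviation extension_degree :: "complex set \<Rightarrow> complex set \<Rightarrow> nat"
  where "extension_degree L K \<equiv> ring.dim complex_field K L"

text \<open>Only meaningful for subfields of cyclotomic fields: for any other \<open>K\<close> the set of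
  candidates is empty and \<open>LEAST\<close> returns an unspecified number.\<close>

definition conductor :: "complex set \<Rightarrow> nat"
  where "conductor K = (LEAST f. 0 < f \<and> K \<subseteq> cyclotomic_field f)"

definition character_conductor :: "('a, 'b) monoid_scheme \<Rightarrow> ('a \<Rightarrow> complex) \<Rightarrow> nat"
  where "character_conductor G \<chi> = conductor (character_field G \<chi>)"

definition number_conductor :: "complex \<Rightarrow> nat"
  where "number_conductor c = conductor (rat_adjoin {c})"

definition p_part :: "nat \<Rightarrow> nat \<Rightarrow> nat"
  where "p_part p n = p ^ Factorial_Ring.multiplicity p n"

definition p_element :: "('a, 'b) monoid_scheme \<Rightarrow> nat \<Rightarrow> 'a \<Rightarrow> bool"
  where "p_element G p g \<longleftrightarrow> g \<in> carrier G \<and> (\<exists>k. group.ord G g = p ^ k)"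

definition property_1_3 :: "('a, 'b) monoid_scheme \<Rightarrow> nat \<Rightarrow> ('a \<Rightarrow> complex) \<Rightarrow> bool"
  where "property_1_3 G p \<chi> \<longleftrightarrow>
    (\<exists>a m. character_conductor G \<chi> = p ^ a * m \<and> \<not> p dvd m \<and>
      (\<exists>g. p_element G p g \<and>
        \<not> p dvd extension_degree (cyclotomic_field (p ^ a)) (rat_adjoin {\<chi> g})))"

end

theory Submission
  imports Defs "Jordan_Normal_Form.Schur_Decomposition" "HOL-Number_Theory.Cong"
begin

text \<open>
Write \<open>\<rat>\<^sub>n\<close> for the \<open>n\<close>-th cyclotomic field and \<open>p\<^sup>a\<close>, with \<open>a \<ge> 2\<close>, for the \<open>p\<close>-part of the conductor
of \<open>\<chi>\<close>. Let \<open>c = \<chi> g\<close> for a \<open>p\<close>-element \<open>g\<close> of order \<open>p\<^sup>k\<close>. As a sum of \<open>p\<^sup>k\<close>-th roots of unity, \<open>c\<close>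
lies in \<open>\<rat>\<^bsub>p^k\<^esub>\<close>, and it lies in \<open>\<rat>(\<chi>)\<close>, hence in \<open>\<rat>\<^bsub>p^a m\<^esub>\<close> with \<open>m\<close> prime to \<open>p\<close>. These two fields
intersect in a subfield of \<open>\<rat>\<^bsub>p^a\<^esub>\<close> (\<open>cyclotomic_field_prime_power_inter\<close>), so \<open>c \<in> \<rat>\<^bsub>p^a\<^esub>\<close>. The theorem
then holds for each \<open>g\<close> separately, because for \<open>c \<in> \<rat>\<^bsub>p^a\<^esub>\<close> both of its conditions say that \<open>c\<close> does
not lie in the next smaller field \<open>\<rat>\<^bsub>p^(a-1)\<^esub>\<close>.

For the conductors this is again the statement about intersections
(\<open>p_part_number_conductor_iff\<close>). For the degree \<open>[\<rat>\<^bsub>p^a\<^esub> : \<rat>(c)]\<close> there are two directions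
(\<open>dvd_extension_degree_iff\<close>). If \<open>c \<in> \<rat>\<^bsub>p^(a-1)\<^esub>\<close>, the tower law makes it a multiple of
\<open>[\<rat>\<^bsub>p^a\<^esub> : \<rat>\<^bsub>p^(a-1)\<^esub>] = p\<close>. If \<open>c \<notin> \<rat>\<^bsub>p^(a-1)\<^esub>\<close>, then \<open>c\<close> is moved by every nontrivial
automorphism of \<open>\<rat>\<^bsub>p^a\<^esub>\<close> over \<open>\<rat>\<^sub>p\<close>: these automorphisms form a cyclic \<open>p\<close>-group, and its unique
subgroup of order \<open>p\<close> has fixed field \<open>\<rat>\<^bsub>p^(a-1)\<^esub>\<close>. So \<open>c\<close> has \<open>p\<^bsup>a-1\<^esup>\<close> conjugates over \<open>\<rat>\<^sub>p\<close> and
generates \<open>\<rat>\<^bsub>p^a\<^esub>\<close> over \<open>\<rat>\<^sub>p\<close>. Consequently \<open>\<rat>\<^bsub>p^a\<^esub>\<close> arises from \<open>\<rat>(c)\<close> by adjoining a primitive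
\<open>p\<close>-th root of unity, which takes degree at most \<open>p - 1\<close>, and a positive number below \<open>p\<close> is not
divisible by \<open>p\<close>.

Galois groups do not appear explicitly. Their role is played by one fact, equivalent to the
irreducibility of the cyclotomic polynomials: a rational polynomial that vanishes at an \<open>n\<close>-th root of
unity \<open>w\<close> also vanishes at \<open>w\<^sup>j\<close> for all \<open>j\<close> prime to \<open>n\<close> (\<open>rational_poly_root_of_unity_conjugate\<close>).
An element of a cyclotomic field is written as a rational polynomial in \<open>\<zeta>\<^sub>n\<close>, and its conjugates are the
values of that polynomial at powers of \<open>\<zeta>\<^sub>n\<close>. Fixed fields are computed by averaging over conjugates
(\<open>fixed_by_conjugates_in_cyclotomic_field\<close>).
\<close>

section \<open>Conjugates of roots of unity\<close>

lemma prime_dvd_binomial_error: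
  fixes x y :: "'a::comm_ring_1"
  assumes q: "Factorial_Ring.prime q"
  shows "of_nat q dvd (x + y) ^ q - (x ^ q + y ^ q)"
proof -
  have q1: "q > 1" using q by (rule prime_gt_1_nat)
  have "(x + y) ^ q = (\<Sum>k\<le>q. of_nat (q choose k) * x ^ k * y ^ (q - k))"
    by (rule binomial_ring)
  also have "{..q} = {0, q} \<union> {1..<q}" using q1 by auto
  also have "(\<Sum>k\<in>{0, q} \<union> {1..<q}. of_nat (q choose k) * x ^ k * y ^ (q - k))
      = (y ^ q + x ^ q) + (\<Sum>k\<in>{1..<q}. of_nat (q choose k) * x ^ k * y ^ (q - k))"
    using q1 by (subst sum.union_disjoint) auto
  finally have "(x + y) ^ q - (x ^ q + y ^ q)
      = (\<Sum>k\<in>{1..<q}. of_nat (q choose k) * x ^ k * y ^ (q - k))" by simp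
  moreover have "(of_nat q :: 'a) dvd of_nat (q choose k) * x ^ k * y ^ (q - k)" if "k \<in> {1..<q}" for k
  proof -
    have "q dvd (q choose k)" using that q by (intro dvd_choose_prime) auto
    then have "(of_nat q :: 'a) dvd of_nat (q choose k)" by (metis dvd_def of_nat_mult)
    then show ?thesis by (simp add: mult.assoc)
  qed
  ultimately show ?thesis by (metis (no_types, lifting) dvd_sum)
qed

lemma prime_dvd_power_minus_self_int:
  fixes a :: int
  assumes q: "Factorial_Ring.prime q"
  shows "of_nat q dvd a ^ q - a"
proof (induction a rule: int_induct[where k = 0])
  case base
  then show ?case using prime_gt_0_nat[OF q] by (simp add: zero_power)
next
  case (step1 i)
  have "(i + 1) ^ q - (i + 1) = ((i + 1) ^ q - (i ^ q + 1 ^ q)) + (i ^ q - i)" by simp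
  then show ?case using prime_dvd_binomial_error[OF q, of i 1] step1 by (metis dvd_add)
next
  case (step2 i)
  have "(i - 1) ^ q - (i - 1) = (i ^ q - i) - (((i - 1) + 1) ^ q - ((i - 1) ^ q + 1 ^ q))" by simp
  then show ?case using prime_dvd_binomial_error[OF q, of "i - 1" 1] step2 by (metis dvd_diff)
qed

text \<open>The Frobenius identity \<open>f(X\<^sup>q) = f(X)\<^sup>q\<close> over the field with \<open>q\<close> elements, stated as a
divisibility so that it can be evaluated at complex numbers.\<close>

lemma frobenius_int_poly:
  fixes f :: "int poly"
  assumes q: "Factorial_Ring.prime q"
  shows "of_nat q dvd pcompose f (monom 1 q) - f ^ q"
proof (induction f)
  case 0
  then show ?case using prime_gt_0_nat[OF q] by (simp add: zero_power)
next
  case (pCons a f)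
  let ?Q = "of_nat q :: int poly" and ?m = "monom 1 q :: int poly" and ?X = "monom 1 1 :: int poly"
  have m: "?m = ?X ^ q" by (simp add: monom_power)
  have e: "pCons a f = [:a:] + ?X * f" by (simp add: monom_Suc)
  have a: "?Q dvd [:a ^ q - a:]"
  proof -
    obtain b where "a ^ q - a = of_nat q * b" using prime_dvd_power_minus_self_int[OF q, of a] by (auto elim: dvdE)
    then have "[:a ^ q - a:] = ?Q * [:b:]" by (simp add: of_nat_poly)
    then show ?thesis by (metis dvd_triv_left)
  qed
  have "pcompose (pCons a f) ?m - pCons a f ^ q
      = ?m * (pcompose f ?m - f ^ q) - ([:a:] ^ q - [:a:])
        - (([:a:] + ?X * f) ^ q - ([:a:] ^ q + (?X * f) ^ q))"
    unfolding pcompose_pCons by (simp add: e m power_mult_distrib algebra_simps)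
  moreover have "[:a:] ^ q - [:a:] = [:a ^ q - a:]" by (simp add: poly_const_pow)
  ultimately show ?case
    using pCons.IH a prime_dvd_binomial_error[OF q, of "[:a:]" "?X * f"]
    by (metis dvd_diff dvd_mult)
qed

text \<open>A primitive integer polynomial of least degree with root \<open>w\<close>. Division with remainder shows
that it divides a constant multiple of any other annihilating polynomial, and Gauss's lemma
removes the constant. Working over the integers is what allows reduction modulo a prime below.\<close>

lemma exists_minimal_int_poly:
  fixes w :: complex
  assumes g: "g \<noteq> 0" "poly (of_int_poly g) w = 0"
  obtains f :: "int poly" where "f \<noteq> 0" "degree f > 0"
    "\<And>h. poly (of_int_poly h) w = 0 \<longleftrightarrow> f dvd h"
proof -
  let ?P = "\<lambda>f :: int poly. f \<noteq> 0 \<and> poly (of_int_poly f) w = 0"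
  define d where "d = (LEAST d. \<exists>f. ?P f \<and> degree f = d)"
  have "\<exists>d f. ?P f \<and> degree f = d" using g by blast
  then have "\<exists>f. ?P f \<and> degree f = d" unfolding d_def by (rule LeastI_ex)
  then obtain f0 where f0: "f0 \<noteq> 0" "poly (of_int_poly f0) w = 0" "degree f0 = d" by blast
  have min: "d \<le> degree f" if "?P f" for f
    unfolding d_def by (rule Least_le) (use that in blast)
  define f where "f = primitive_part f0"
  have f: "f \<noteq> 0" "content f = 1" "degree f = d"
    using f0 by (auto simp: f_def degree_primitive_part)
  have "poly (of_int_poly f0) w = of_int (content f0) * poly (of_int_poly f) w"
  proof -
    have "f0 = smult (content f0) f" by (simp add: f_def)
    then have "poly (of_int_poly f0) w = poly (of_int_poly (smult (content f0) f)) w" by simp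
    then show ?thesis by (simp add: hom_distribs)
  qed
  then have fw: "poly (of_int_poly f) w = 0" using f0 by simp
  have dpos: "d > 0"
  proof (rule ccontr)
    assume "\<not> d > 0"
    then obtain c where "f = [:c:]" using f by (metis degree_eq_zeroE gr0I)
    then show False using f fw by auto
  qed
  have "f dvd h" if h: "poly (of_int_poly h) w = 0" for h
  proof -
    obtain s r where sr: "pseudo_divmod h f = (s, r)" by fastforce
    define c where "c = coeff f (degree f) ^ (Suc (degree h) - degree f)"
    have c0: "c \<noteq> 0" unfolding c_def using f(1) by (intro power_not_zero) simp
    have eq: "smult c h = f * s + r" and deg: "r = 0 \<or> degree r < degree f"
      using pseudo_divmod[OF f(1) sr] by (auto simp: c_def)
    have "poly (of_int_poly (smult c h)) w = poly (of_int_poly (f * s + r)) w" using eq by simp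
    then have "poly (of_int_poly r) w = 0" using h fw by (simp add: hom_distribs)
    then have "r = 0" using deg min f by (metis not_le)
    \<comment> \<open>Gauss's lemma: \<open>f\<close> has content 1, so the factor \<open>c\<close> can be cancelled.\<close>
    then have eq': "smult c h = f * s" using eq by simp
    then have "content (smult c h) = content s" using f by (simp add: content_mult)
    then have "c dvd content s" by (metis content_smult dvd_triv_left normalize_dvd_iff dvd_normalize_iff mult_dvd_mono dvd_refl dvd_mult_left)
    then have "[:c:] dvd s" by (simp add: const_poly_dvd_iff_dvd_content)
    then obtain t where "s = smult c t" by (auto elim!: dvdE)
    then have "smult c h = smult c (f * t)" using eq' by simp
    then have "h = f * t" using c0 by (metis smult_cancel)
    then show ?thesis by simp
  qed
  moreover have "poly (of_int_poly h) w = 0" if "f dvd h" for h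
    using that fw by (auto elim!: dvdE simp: hom_distribs)
  ultimately show ?thesis using that[of f] f dpos by auto
qed


text \<open>If \<open>f\<close> has leading coefficient \<open>\<plusminus>1\<close> and positive degree, then \<open>\<int>[X]/(f)\<close> is free over \<open>\<int>\<close> with
1 as a basis element, so \<open>q\<close> divides the constant \<open>a\<close> in this ring only if it does so in \<open>\<int>\<close>. The
proof reduces \<open>K\<close> modulo \<open>f\<close> and compares constant coefficients.\<close>

lemma int_dvd_const_of_unit_lead_dvd:
  fixes f K :: "int poly"
  assumes f: "degree f > 0" and unit: "\<bar>lead_coeff f\<bar> = 1"
    and dvd: "f dvd [:a:] - of_nat q * K"
  shows "int q dvd a"
proof -
  obtain s r where sr: "pseudo_divmod K f = (s, r)" by fastforce
  define c where "c = coeff f (degree f) ^ (Suc (degree K) - degree f)"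
  have c: "\<bar>c\<bar> = 1" using unit by (simp add: c_def power_abs)
  have f0: "f \<noteq> 0" using f by auto
  have eq: "smult c K = f * s + r" and deg: "r = 0 \<or> degree r < degree f"
    using pseudo_divmod[OF f0 sr] by (auto simp: c_def)
  have "f dvd smult c ([:a:] - of_nat q * K)" using dvd by (rule dvd_smult)
  also have "smult c ([:a:] - of_nat q * K) = [:c * a:] - of_nat q * smult c K"
    by (simp add: smult_diff_right)
  also have "\<dots> = ([:c * a:] - of_nat q * r) - f * (of_nat q * s)"
    unfolding eq by (simp add: algebra_simps)
  finally have "f dvd [:c * a:] - of_nat q * r"
    by (metis dvd_diff_left_iff dvd_triv_left)
  moreover have "degree ([:c * a:] - of_nat q * r) < degree f"
  proof (rule degree_diff_less)
    show "degree (of_nat q * r) < degree f"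
      using deg f by (auto simp: of_nat_poly intro: le_less_trans[OF degree_smult_le])
  qed (use f in simp)
  ultimately have "[:c * a:] - of_nat q * r = 0"
    by (metis dvd_imp_degree_le not_le)
  then have "[:c * a:] = smult (int q) r" by (simp add: of_nat_poly)
  then have "c * a = int q * coeff r 0" by (metis coeff_pCons_0 coeff_smult)
  then have "int q dvd c * a" by simp
  then show ?thesis using c by (metis abs_mult dvd_abs_iff mult_1)
qed

text \<open>Dedekind's argument. Let \<open>f\<close> be the minimal polynomial of \<open>w\<close> and \<open>X\<^sup>n - 1 = f e\<close>. If \<open>w\<^sup>q\<close> were
not a root of \<open>f\<close>, it would be a root of \<open>e\<close>, and differentiating at \<open>w\<^sup>q\<close> would show that
\<open>f(w\<^sup>q)\<close> divides \<open>n\<close> in \<open>\<int>[w]\<close>. But \<open>f(w\<^sup>q)\<close> is congruent to \<open>f(w)\<^sup>q = 0\<close> modulo \<open>q\<close>, so \<open>q\<close>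
would divide \<open>n\<close> in \<open>\<int>[w]\<close> and therefore in \<open>\<int>\<close>.\<close>

lemma root_of_unity_power_prime_root:
  fixes w :: complex
  assumes n: "n > 0" "w ^ n = 1" and q: "Factorial_Ring.prime q" "\<not> q dvd n"
    and h: "poly (of_int_poly h) w = 0"
  shows "poly (of_int_poly h) (w ^ q) = 0"
proof -
  let ?ev = "\<lambda>p :: int poly. \<lambda>z :: complex. poly (of_int_poly p) z"
  define g :: "int poly" where "g = monom 1 n - 1"
  have ev_g: "?ev g z = z ^ n - 1" for z by (simp add: g_def hom_distribs poly_monom)
  have "coeff g n = 1" using n by (simp add: g_def)
  then have g0: "g \<noteq> 0" by auto
  obtain f where f: "f \<noteq> 0" "degree f > 0" "\<And>h. ?ev h w = 0 \<longleftrightarrow> f dvd h"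
    using exists_minimal_int_poly[OF g0] ev_g n by auto
  have fw: "?ev f w = 0" using f(3)[of f] by simp
  obtain e where e: "g = f * e" using f(3)[of g] ev_g n by (auto elim: dvdE)
  have "lead_coeff g = 1"
  proof -
    have "degree g \<le> n" unfolding g_def by (intro degree_diff_le) (auto simp: degree_monom_le)
    moreover have "n \<le> degree g" using \<open>coeff g n = 1\<close> by (intro le_degree) simp
    ultimately have "degree g = n" by simp
    then show ?thesis using \<open>coeff g n = 1\<close> by simp
  qed
  then have "lead_coeff f * lead_coeff e = 1" by (simp add: e lead_coeff_mult)
  then have unit: "\<bar>lead_coeff f\<bar> = 1" by (metis zmult_eq_1_iff abs_1 abs_minus_cancel)
  have "?ev f (w ^ q) = 0"
  proof (rule ccontr)
    assume nz: "?ev f (w ^ q) \<noteq> 0"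
    let ?u = "w ^ q"
    have un: "?u ^ n = 1" using n by (metis power_commutes power_mult power_one mult.commute)
    have "?ev f ?u * ?ev e ?u = 0" using ev_g[of ?u] un by (simp add: e hom_distribs)
    then have eu: "?ev e ?u = 0" using nz by simp
    have "pderiv g = f * pderiv e + e * pderiv f" by (simp add: e pderiv_mult)
    then have "?ev (pderiv g) ?u = ?ev f ?u * ?ev (pderiv e) ?u"
      using eu by (simp add: hom_distribs)
    moreover have "?ev (pderiv g) ?u = of_nat n * ?u ^ (n - 1)"
      by (simp add: g_def pderiv_diff pderiv_monom hom_distribs poly_monom)
    ultimately have "?ev f ?u * ?ev (pderiv e) ?u * ?u = of_nat n * (?u ^ (n - 1) * ?u)" by simp
    then have fe: "?ev f ?u * ?ev (pderiv e) ?u * ?u = of_nat n"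
      using un n by (metis power_minus_mult mult.right_neutral)
    obtain k where k: "pcompose f (monom 1 q) - f ^ q = of_nat q * k"
      using frobenius_int_poly[OF q(1), of f] by (auto elim: dvdE)
    then have "pcompose f (monom 1 q) = f ^ q + of_nat q * k" by (simp add: algebra_simps)
    then have "?ev (pcompose f (monom 1 q)) w = ?ev (f ^ q + of_nat q * k) w" by simp
    then have fk: "?ev f ?u = of_nat q * ?ev k w"
      using fw prime_gt_0_nat[OF q(1)]
      by (simp add: hom_distribs poly_pcompose poly_monom zero_power)
    \<comment> \<open>The quotient of \<open>n\<close> by \<open>q\<close> in \<open>\<int>[w]\<close>, written as a polynomial in \<open>w\<close>.\<close>
    define K where "K = k * pcompose (pderiv e) (monom 1 q) * monom 1 q"
    have "?ev K w = ?ev k w * ?ev (pderiv e) ?u * ?u"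
      by (simp add: K_def hom_distribs poly_pcompose poly_monom)
    then have "of_nat q * ?ev K w = of_nat n" using fe fk by (simp add: mult.assoc)
    then have "?ev ([:int n:] - of_nat q * K) w = 0" by (simp add: hom_distribs)
    then have "f dvd [:int n:] - of_nat q * K" using f(3) by blast
    then have "int q dvd int n" using f(2) unit by (intro int_dvd_const_of_unit_lead_dvd)
    then show False using q(2) by simp
  qed
  moreover obtain t where "h = f * t" using f(3)[of h] h by (auto elim: dvdE)
  ultimately show ?thesis by (simp add: hom_distribs)
qed

text \<open>Polynomials over \<open>\<rat>\<close>, viewed inside \<open>\<complex>[X]\<close> so that they can be evaluated at complex numbers
without a coefficient embedding.\<close>

definition rational_poly :: "complex poly \<Rightarrow> bool"
  where "rational_poly h \<longleftrightarrow> (\<forall>i. coeff h i \<in> \<rat>)"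

lemma rational_poly_clear_denominators:
  assumes "rational_poly h"
  obtains d :: nat and g :: "int poly" where "d > 0" "smult (of_nat d) h = of_int_poly g"
proof -
  have "\<exists>d g. d > 0 \<and> smult (of_nat d) h = of_int_poly g" using assms
  proof (induction h)
    case 0
    have "smult (of_nat 1) 0 = (of_int_poly 0 :: complex poly)" by simp
    then show ?case by blast
  next
    case (pCons a h)
    have a: "a \<in> \<rat>" using pCons.prems[unfolded rational_poly_def, rule_format, of 0] by simp
    have "coeff h i \<in> \<rat>" for i using pCons.prems[unfolded rational_poly_def, rule_format, of "Suc i"] by simp
    then obtain d g where dg: "d > 0" "smult (of_nat d) h = of_int_poly g"
      using pCons.IH by (auto simp: rational_poly_def)
    obtain m k :: int where mk: "k > 0" "a = of_int m / of_int k" 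
      using a by (cases rule: Rats_cases') auto
    have "smult (of_nat (d * nat k)) (pCons a h) = of_int_poly (pCons (int d * m) (smult k g))"
    proof -
      have "of_nat (d * nat k) * a = of_int (int d * m)" using mk by simp
      moreover have "smult (of_nat (d * nat k)) h = of_int_poly (smult k g)"
        using mk dg(2)[symmetric] by (simp add: hom_distribs mult.commute)
      ultimately show ?thesis by (simp add: hom_distribs)
    qed
    moreover have "d * nat k > 0" using dg mk by simp
    ultimately show ?case by blast
  qed
  then show ?thesis using that by blast
qed

text \<open>The substitute for the automorphism \<open>w \<mapsto> w\<^sup>j\<close> of the field \<open>\<rat>(w)\<close>: every algebraic relation of
\<open>w\<close> over \<open>\<rat>\<close> is inherited by \<open>w\<^sup>j\<close>. The exponent is built up one prime factor at a time.\<close>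

lemma rational_poly_root_of_unity_conjugate:
  fixes w :: complex
  assumes n: "n > 0" "w ^ n = 1" and j: "coprime j n"
    and h: "rational_poly h" "poly h w = 0"
  shows "poly h (w ^ j) = 0"
proof -
  obtain d g where dg: "d > 0" "smult (of_nat d) h = of_int_poly g"
    using rational_poly_clear_denominators[OF h(1)] .
  have ev: "poly (of_int_poly g) z = of_nat d * poly h z" for z
    using arg_cong[OF dg(2), of "\<lambda>p. poly p z"] by simp
  have "poly (of_int_poly g) (w ^ j) = 0" if "poly (of_int_poly g) w = 0" "w ^ n = 1" for w :: complex
    using that j
  proof (induction j arbitrary: w rule: prime_divisors_induct)
    case zero
    then show ?case using n by simp
  next
    case (unit x)
    then show ?case by simp
  next
    case (factor q x)
    have "poly (of_int_poly g) (w ^ q) = 0"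
      by (rule root_of_unity_power_prime_root[of n])
        (use factor n in \<open>auto simp: prime_imp_coprime_nat coprime_mult_left_iff dest: coprime_absorb_left\<close>)
    moreover have "(w ^ q) ^ n = 1" using factor.prems by (metis power_commutes power_mult power_one mult.commute)
    ultimately show ?case using factor by (simp add: power_mult)
  qed
  then show ?thesis using ev h n dg(1) by (metis mult_eq_0_iff of_nat_eq_0_iff not_gr0 mult_zero_right)
qed

section \<open>Cyclotomic fields\<close>

lemma field_complex_field: "field complex_field"
  by (rule field_from_type_algebra)

interpretation complex_field: domain complex_field
  by (rule field.axioms(1)[OF field_complex_field])

lemma complex_field_simps [simp]:
  "carrier complex_field = UNIV" "monoid.mult complex_field = (*)" "monoid.one complex_field = 1"
  "ring.zero complex_field = 0" "ring.add complex_field = (+)"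
  by (simp_all add: ring_of_type_algebra_def)

lemma complex_field_uminus [simp]: "\<ominus>\<^bsub>complex_field\<^esub> x = - x"
  by (rule complex_field.minus_equality) auto

lemma complex_field_inv [simp]: "x \<noteq> 0 \<Longrightarrow> inv\<^bsub>complex_field\<^esub> x = inverse x"
  by (rule complex_field.comm_inv_char) auto

lemma complex_field_pow [simp]: "x [^]\<^bsub>complex_field\<^esub> (n :: nat) = x ^ n"
  by (induction n) (auto simp: mult.commute)

abbreviation complex_subfield :: "complex set \<Rightarrow> bool"
  where "complex_subfield K \<equiv> subfield K complex_field"

context
  fixes K assumes K: "complex_subfield K"
begin

lemma complex_subfield_basic_closed:
  shows complex_subfield_0: "0 \<in> K" and complex_subfield_1: "1 \<in> K"
    and complex_subfield_add: "x \<in> K \<Longrightarrow> y \<in> K \<Longrightarrow> x + y \<in> K"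
    and complex_subfield_mult: "x \<in> K \<Longrightarrow> y \<in> K \<Longrightarrow> x * y \<in> K"
    and complex_subfield_uminus: "x \<in> K \<Longrightarrow> - x \<in> K"
  using subringE[OF subfieldE(1)[OF K]] by auto

lemma complex_subfield_inverse: "x \<in> K \<Longrightarrow> inverse x \<in> K"
  using complex_field.subfield_m_inv(1)[OF K, of x] complex_subfield_0 by (cases "x = 0") auto

lemma complex_subfield_power: "x \<in> K \<Longrightarrow> x ^ n \<in> K"
  by (induction n) (auto intro: complex_subfield_basic_closed)

lemma complex_subfield_sum: "(\<And>i. i \<in> A \<Longrightarrow> f i \<in> K) \<Longrightarrow> sum f A \<in> K"
  by (induction A rule: infinite_finite_induct) (auto intro: complex_subfield_basic_closed)

lemma complex_subfield_of_nat: "of_nat n \<in> K"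
  by (induction n) (auto intro: complex_subfield_basic_closed)

lemma complex_subfield_of_int: "of_int i \<in> K"
  by (cases i rule: int_cases2) (auto intro: complex_subfield_of_nat complex_subfield_uminus)

lemma Rats_subset_complex_subfield: "\<rat> \<subseteq> K"
proof
  fix x :: complex assume "x \<in> \<rat>"
  then obtain a b :: int where "x = of_int a / of_int b" by (cases rule: Rats_cases') auto
  then show "x \<in> K"
    by (auto simp: divide_inverse intro!: complex_subfield_mult complex_subfield_inverse complex_subfield_of_int)
qed

lemma complex_subfield_poly:
  assumes "\<And>i. coeff h i \<in> K" "x \<in> K"
  shows "poly h x \<in> K"
  unfolding poly_altdef using assms
  by (intro complex_subfield_sum complex_subfield_mult complex_subfield_power) auto

lemma rat_adjoin_subset: "S \<subseteq> K \<Longrightarrow> rat_adjoin S \<subseteq> K"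
  by (rule field.generate_field_min_subfield1[OF field_complex_field]) (use K in auto)

end

lemma complex_subfield_rat_adjoin: "complex_subfield (rat_adjoin S)"
  by (rule field.generate_field_is_subfield[OF field_complex_field]) simp

lemma complex_subfield_Rats: "complex_subfield \<rat>"
proof (rule field.subfieldI'[OF field_complex_field])
  show "subring \<rat> complex_field"
    by (rule complex_field.subringI) auto
qed auto

lemma subset_rat_adjoin: "S \<subseteq> rat_adjoin S"
  by (auto intro: generate_field.incl)

definition zeta :: "nat \<Rightarrow> complex"
  where "zeta n = cis (2 * pi / real n)"

lemma cyclotomic_field_altdef: "cyclotomic_field n = rat_adjoin {zeta n}"
  by (simp add: cyclotomic_field_def zeta_def)

lemma zeta_power_self: "n > 0 \<Longrightarrow> zeta n ^ n = 1"
  by (simp add: zeta_def DeMoivre)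

lemma zeta_mult_power: "r > 0 \<Longrightarrow> zeta (n * r) ^ r = zeta n"
  by (cases "n = 0") (simp_all add: zeta_def DeMoivre field_simps)

lemma zeta_power_eq_iff:
  assumes "n > 0"
  shows "zeta n ^ i = zeta n ^ j \<longleftrightarrow> i mod n = j mod n"
proof -
  have red: "zeta n ^ i = zeta n ^ (i mod n)" for i
  proof -
    have "zeta n ^ i = zeta n ^ (n * (i div n) + i mod n)" by simp
    also have "\<dots> = zeta n ^ (i mod n)"
      unfolding power_add power_mult using zeta_power_self[OF assms] by simp
    finally show ?thesis .
  qed
  have "inj_on (\<lambda>k. cis (2 * pi * real k / real n)) {..<n}"
    using bij_betw_roots_unity[OF assms] by (rule bij_betw_imp_inj_on)
  moreover have "cis (2 * pi * real k / real n) = zeta n ^ k" for k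
    by (simp add: zeta_def DeMoivre mult_ac)
  ultimately have "inj_on (\<lambda>k. zeta n ^ k) {..<n}" by simp
  then have "zeta n ^ (i mod n) = zeta n ^ (j mod n) \<longleftrightarrow> i mod n = j mod n"
    using assms by (auto simp: inj_on_def)
  then show ?thesis using red by metis
qed

lemma zeta_power_eq_1_iff: "n > 0 \<Longrightarrow> zeta n ^ i = 1 \<longleftrightarrow> n dvd i"
  using zeta_power_eq_iff[of n i 0] by (simp add: dvd_eq_mod_eq_0)

lemma rational_poly_monom: "a \<in> \<rat> \<Longrightarrow> rational_poly (monom a n)"
  by (simp add: rational_poly_def)

lemma rational_poly_pCons: "rational_poly (pCons a h) \<longleftrightarrow> a \<in> \<rat> \<and> rational_poly h"
  by (auto simp: rational_poly_def coeff_pCons split: nat.split)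

lemma rational_poly_0: "rational_poly 0" and rational_poly_1: "rational_poly 1"
  by (simp_all add: rational_poly_def)

lemma rational_poly_add: "rational_poly f \<Longrightarrow> rational_poly g \<Longrightarrow> rational_poly (f + g)"
  and rational_poly_diff: "rational_poly f \<Longrightarrow> rational_poly g \<Longrightarrow> rational_poly (f - g)"
  by (auto simp: rational_poly_def)

lemma rational_poly_mult: "rational_poly f \<Longrightarrow> rational_poly g \<Longrightarrow> rational_poly (f * g)"
  by (auto simp: rational_poly_def coeff_mult intro!: complex_subfield_sum[OF complex_subfield_Rats])

lemma rational_poly_power: "rational_poly f \<Longrightarrow> rational_poly (f ^ n)"
  by (induction n) (simp_all add: rational_poly_1 rational_poly_mult)

lemma rational_poly_sum: "(\<And>i. i \<in> A \<Longrightarrow> rational_poly (f i)) \<Longrightarrow> rational_poly (sum f A)"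
  by (auto simp: rational_poly_def coeff_sum intro!: complex_subfield_sum[OF complex_subfield_Rats])

lemma rational_poly_pcompose: "rational_poly f \<Longrightarrow> rational_poly g \<Longrightarrow> rational_poly (pcompose f g)"
proof (induction f)
  case (pCons a f)
  then show ?case
    by (auto simp: rational_poly_pCons rational_poly_0 intro!: rational_poly_add rational_poly_mult)
qed (simp add: rational_poly_0)

lemma cyclotomic_field_subfield: "complex_subfield (cyclotomic_field n)"
  unfolding cyclotomic_field_altdef by (rule complex_subfield_rat_adjoin)

lemma zeta_in_cyclotomic_field: "zeta n \<in> cyclotomic_field n"
  unfolding cyclotomic_field_altdef using subset_rat_adjoin by blast

lemma cyclotomic_field_subset_mult:
  assumes "r > 0"
  shows "cyclotomic_field n \<subseteq> cyclotomic_field (n * r)"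
  unfolding cyclotomic_field_altdef[of n]
proof (rule rat_adjoin_subset[OF cyclotomic_field_subfield])
  have "zeta (n * r) ^ r \<in> cyclotomic_field (n * r)"
    by (intro complex_subfield_power[OF cyclotomic_field_subfield] zeta_in_cyclotomic_field)
  then show "{zeta n} \<subseteq> cyclotomic_field (n * r)" using assms by (simp only: zeta_mult_power) simp
qed

lemma cyclotomic_field_mono:
  assumes "m dvd n" "n > 0"
  shows "cyclotomic_field m \<subseteq> cyclotomic_field n"
proof -
  obtain r where "n = m * r" using assms by (auto elim: dvdE)
  then show ?thesis using cyclotomic_field_subset_mult[of r m] assms by simp
qed

lemma rational_poly_in_cyclotomic_field:
  assumes "rational_poly h" "z \<in> cyclotomic_field n"
  shows "poly h z \<in> cyclotomic_field n"
  using assms Rats_subset_complex_subfield[OF cyclotomic_field_subfield]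
  by (intro complex_subfield_poly[OF cyclotomic_field_subfield]) (auto simp: rational_poly_def)

lemma root_of_unity_algebraic:
  assumes n: "n > 0" "w ^ n = 1"
  shows "(complex_field.algebraic over \<rat>) w"
proof -
  define p where "p = 1 # replicate (n - 1) 0 @ [- 1 :: complex]"
  have "p \<in> carrier (univ_poly complex_field \<rat>)"
    by (auto simp: p_def univ_poly_def polynomial_def)
  moreover have "complex_field.eval p w = 0"
  proof -
    have "complex_field.eval (replicate (n - 1) 0 @ [- 1]) w = complex_field.eval [- 1] w"
      using complex_field.eval_replicate[of "[- 1]" w "n - 1"] by simp
    then show ?thesis using n by (simp add: p_def)
  qed
  ultimately show ?thesis
    by (intro complex_field.algebraicI[of p]) (auto simp: p_def)
qed

text \<open>Since \<open>\<zeta>\<^sub>n\<close> is algebraic, the ring \<open>\<rat>[\<zeta>\<^sub>n]\<close> is already a field, so no quotients are needed.\<close>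

lemma cyclotomic_field_eq_rational_polys:
  assumes n: "n > 0"
  shows "cyclotomic_field n = {poly h (zeta n) | h. rational_poly h}"
proof -
  let ?S = "complex_field.simple_extension \<rat> (zeta n)"
  have "complex_subfield ?S"
    using complex_field.simple_extension_is_subfield[OF complex_subfield_Rats, of "zeta n"]
      root_of_unity_algebraic[OF n zeta_power_self[OF n]] by simp
  moreover have "zeta n \<in> ?S"
    using complex_field.simple_extension_mem[OF subfieldE(1)[OF complex_subfield_Rats], of "zeta n"]
    by simp
  ultimately have "cyclotomic_field n \<subseteq> ?S"
    unfolding cyclotomic_field_altdef by (intro rat_adjoin_subset) auto
  moreover have "z \<in> {poly h (zeta n) | h. rational_poly h}" if "z \<in> ?S" for z
    using that
  proof (induction rule: complex_field.simple_extension.induct)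
    case zero
    show ?case unfolding mem_Collect_eq by (rule exI[of _ 0]) (simp add: rational_poly_0)
  next
    case (lin k1 k2)
    then obtain h where "k1 = poly h (zeta n)" "rational_poly h" by auto
    then show ?case
      using lin unfolding mem_Collect_eq
      by (intro exI[of _ "pCons k2 h"]) (simp add: rational_poly_pCons mult.commute)
  qed
  ultimately show ?thesis
    using rational_poly_in_cyclotomic_field zeta_in_cyclotomic_field by blast
qed

text \<open>If \<open>r\<close> divides a power of \<open>n\<close>, this is the trace from \<open>\<rat>\<^bsub>nr\<^esub>\<close> to \<open>\<rat>\<^sub>n\<close>. On a power \<open>\<zeta>\<^bsub>nr\<^esub>\<^sup>i\<close> it is, up to a factor, a geometric
sum of \<open>r\<close>-th roots of unity. This vanishes unless \<open>r\<close> divides \<open>i\<close>, and then \<open>\<zeta>\<^bsub>nr\<^esub>\<^sup>i\<close> is a power of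
\<open>\<zeta>\<^sub>n\<close>. The factor \<open>s\<close>, which only permutes the summands, makes it possible to restrict the exponents to
those congruent to 1 modulo a number prime to \<open>r\<close>.\<close>

lemma sum_conjugates_in_cyclotomic_field:
  assumes n: "n > 0" and r: "r > 0" and s: "coprime s r" and h: "rational_poly h"
  shows "(\<Sum>t<r. poly h (zeta (n * r) ^ (1 + n * s * t))) \<in> cyclotomic_field n"
proof -
  let ?z = "zeta (n * r)"
  have zn: "?z ^ n = zeta r" using zeta_mult_power[OF n, of r] by (simp add: mult.commute)
  have term_in: "coeff h i * (\<Sum>t<r. (?z ^ (1 + n * s * t)) ^ i) \<in> cyclotomic_field n" for i
  proof -
    have "(?z ^ (1 + n * s * t)) ^ i = ?z ^ i * (zeta r ^ (s * i)) ^ t" for t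
      unfolding zn[symmetric] by (simp add: power_mult[symmetric] power_add[symmetric] algebra_simps)
    then have eq: "(\<Sum>t<r. (?z ^ (1 + n * s * t)) ^ i) = ?z ^ i * (\<Sum>t<r. (zeta r ^ (s * i)) ^ t)"
      by (simp add: sum_distrib_left)
    show ?thesis
    proof (cases "r dvd i")
      case True
      then obtain k where k: "i = r * k" by (auto elim: dvdE)
      have "zeta r ^ (s * i) = 1" using r True by (simp add: zeta_power_eq_1_iff)
      moreover have "?z ^ i = zeta n ^ k" using r by (simp add: k power_mult zeta_mult_power)
      ultimately have "(\<Sum>t<r. (?z ^ (1 + n * s * t)) ^ i) = of_nat r * zeta n ^ k"
        using eq by simp
      then have "coeff h i * (\<Sum>t<r. (?z ^ (1 + n * s * t)) ^ i) = poly (monom (coeff h i * of_nat r) k) (zeta n)"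
        by (simp add: poly_monom)
      moreover have "rational_poly (monom (coeff h i * of_nat r) k)"
        using h by (intro rational_poly_monom Rats_mult) (auto simp: rational_poly_def)
      ultimately show ?thesis
        using rational_poly_in_cyclotomic_field zeta_in_cyclotomic_field by metis
    next
      case False
      let ?e = "zeta r ^ (s * i)"
      have "\<not> r dvd s * i" using False s by (simp add: coprime_commute coprime_dvd_mult_right_iff)
      then have "?e \<noteq> 1" using r by (simp add: zeta_power_eq_1_iff)
      moreover have "?e ^ r = 1" using r zeta_power_self[OF r]
        by (metis power_commutes power_mult power_one mult.commute)
      ultimately have "(\<Sum>t<r. ?e ^ t) = 0" by (simp add: geometric_sum)
      then show ?thesis unfolding eq
        using complex_subfield_0[OF cyclotomic_field_subfield] by simp
    qed
  qed
  have "(\<Sum>t<r. poly h (?z ^ (1 + n * s * t)))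
      = (\<Sum>i\<le>degree h. coeff h i * (\<Sum>t<r. (?z ^ (1 + n * s * t)) ^ i))"
    unfolding poly_altdef sum_distrib_left by (rule sum.swap)
  then show ?thesis
    by (simp only:) (intro complex_subfield_sum[OF cyclotomic_field_subfield] term_in)
qed

text \<open>A number equal to all the conjugates in this sum is their average.\<close>

lemma fixed_by_conjugates_in_cyclotomic_field:
  assumes n: "n > 0" and r: "r > 0" and s: "coprime s r" and h: "rational_poly h"
    and fixed: "\<And>t. t < r \<Longrightarrow> poly h (zeta (n * r) ^ (1 + n * s * t)) = c"
  shows "c \<in> cyclotomic_field n"
proof -
  have "(\<Sum>t<r. poly h (zeta (n * r) ^ (1 + n * s * t))) = of_nat r * c"
    using fixed by simp
  then have "of_nat r * c \<in> cyclotomic_field n"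
    using sum_conjugates_in_cyclotomic_field[OF n r s h] by simp
  moreover have "inverse (of_nat r) \<in> cyclotomic_field n"
    using Rats_subset_complex_subfield[OF cyclotomic_field_subfield, of n] by auto
  ultimately have "inverse (of_nat r) * (of_nat r * c) \<in> cyclotomic_field n"
    by (rule complex_subfield_mult[OF cyclotomic_field_subfield, rotated])
  then show ?thesis using r by (simp add: mult.assoc[symmetric])
qed

lemma coprime_1_plus_mult: "coprime (1 + n * x) (n :: nat)"
  by (rule coprimeI) (metis dvd_add_left_iff dvd_mult2)

text \<open>An element of both fields is fixed by the automorphisms \<open>\<zeta> \<mapsto> \<zeta>\<^sup>j\<close> of \<open>\<rat>\<^bsub>nrm\<^esub>\<close> with
\<open>j = 1 + nmt\<close>, because these fix \<open>\<zeta>\<^bsub>nm\<^esub>\<close>. As \<open>t\<close> varies, they induce on \<open>\<rat>\<^bsub>nr\<^esub>\<close> all automorphisms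
over \<open>\<rat>\<^sub>n\<close>. The condition that \<open>r\<close> divides a power of \<open>n\<close> makes every such \<open>j\<close> prime to \<open>nrm\<close>.\<close>

lemma cyclotomic_field_inter_coprime:
  assumes n: "n > 0" and r: "r > 0" "r dvd n ^ k" and m: "m > 0" "coprime m r"
  shows "cyclotomic_field (n * r) \<inter> cyclotomic_field (n * m) \<subseteq> cyclotomic_field n"
proof
  fix c assume c: "c \<in> cyclotomic_field (n * r) \<inter> cyclotomic_field (n * m)"
  obtain h where h: "rational_poly h" "c = poly h (zeta (n * r))"
    using c cyclotomic_field_eq_rational_polys[of "n * r"] n r by auto
  obtain g where g: "rational_poly g" "c = poly g (zeta (n * m))"
    using c cyclotomic_field_eq_rational_polys[of "n * m"] n m by auto
  let ?w = "zeta (n * r * m)"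
  have wm: "?w ^ m = zeta (n * r)" using m by (simp add: zeta_mult_power)
  have wr: "?w ^ r = zeta (n * m)"
    using zeta_mult_power[OF r(1), of "n * m"] by (simp add: mult_ac)
  \<comment> \<open>The equality of the two expressions for \<open>c\<close>, as a relation for the common root of unity \<open>\<zeta>\<^bsub>nrm\<^esub>\<close>.\<close>
  define H where "H = pcompose h (monom 1 m) - pcompose g (monom 1 r)"
  have H: "rational_poly H"
    unfolding H_def using h g by (intro rational_poly_diff rational_poly_pcompose rational_poly_monom) auto
  have "poly H ?w = 0" using h g wm wr by (simp add: H_def poly_pcompose poly_monom)
  have fixed: "poly h (zeta (n * r) ^ (1 + n * m * t)) = c" for t
  proof -
    define j where "j = 1 + n * m * t"
    have "coprime j n" "coprime j m"
      unfolding j_def using coprime_1_plus_mult[of n "m * t"] coprime_1_plus_mult[of m "n * t"]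
      by (simp_all only: mult_ac)
    moreover have "coprime j r" using r(2) \<open>coprime j n\<close>
      by (meson coprime_divisors coprime_power_right_iff dvd_refl)
    ultimately have "coprime j (n * r * m)" by simp
    then have "poly H (?w ^ j) = 0"
      using n r m \<open>poly H ?w = 0\<close> H
      by (intro rational_poly_root_of_unity_conjugate[of "n * r * m"]) (auto intro!: zeta_power_self)
    moreover have "(?w ^ j) ^ m = zeta (n * r) ^ j" "(?w ^ j) ^ r = zeta (n * m) ^ j"
      unfolding wm[symmetric] wr[symmetric] by (simp_all only: power_mult[symmetric] mult.commute)
    moreover have "zeta (n * m) ^ j = zeta (n * m)"
    proof -
      have "j mod (n * m) = 1 mod (n * m)" unfolding j_def by (metis mod_mult_self2)
      then show ?thesis using zeta_power_eq_iff[of "n * m" j 1] n m by simp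
    qed
    ultimately show ?thesis unfolding j_def[symmetric] using g(2) by (simp add: H_def poly_pcompose poly_monom)
  qed
  show "c \<in> cyclotomic_field n"
    by (rule fixed_by_conjugates_in_cyclotomic_field[OF n r(1) m(2) h(1)]) (rule fixed)
qed

lemma cyclotomic_field_prime_power_inter:
  assumes p: "Factorial_Ring.prime p" and a: "a \<ge> 1" and m: "m > 0" "\<not> p dvd m"
  shows "cyclotomic_field (p ^ b) \<inter> cyclotomic_field (p ^ a * m) \<subseteq> cyclotomic_field (p ^ a)"
proof (cases "b \<le> a")
  case True
  then show ?thesis
    using cyclotomic_field_mono[of "p ^ b" "p ^ a"] prime_gt_0_nat[OF p] by (auto simp: le_imp_power_dvd)
next
  case False
  have "p ^ b = p ^ a * p ^ (b - a)" using False by (simp add: power_add[symmetric])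
  moreover have "p ^ (b - a) dvd (p ^ a) ^ b"
  proof -
    have "b - a \<le> a * b" using a by (cases a) auto
    then show ?thesis by (simp add: power_mult[symmetric] le_imp_power_dvd)
  qed
  moreover have "coprime m (p ^ (b - a))"
    using prime_imp_coprime_nat[OF p m(2)] by (simp add: coprime_commute)
  ultimately show ?thesis
    using cyclotomic_field_inter_coprime[of "p ^ a" "p ^ (b - a)" b m] m prime_gt_0_nat[OF p] by simp
qed

section \<open>Degrees of cyclotomic extensions\<close>

(* Unfolding spans to folds of line extensions would hide the closure properties proved below. *)
declare complex_field.Span.simps [simp del]

lemma combine_complex_field:
  "length Ks = length Us \<Longrightarrow> complex_field.combine Ks Us = (\<Sum>i<length Us. Ks ! i * Us ! i)"
proof (induction Ks Us rule: list_induct2)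
  case (Cons k Ks u Us)
  then show ?case by (simp add: sum.lessThan_Suc_shift del: sum.lessThan_Suc)
qed simp

lemma mem_Span_complex_field_iff:
  assumes "complex_subfield K"
  shows "x \<in> complex_field.Span K (map u [0..<n]) \<longleftrightarrow>
    (\<exists>f. (\<forall>i<n. f i \<in> K) \<and> x = (\<Sum>i<n. f i * u i))" (is "?lhs \<longleftrightarrow> ?rhs")
proof
  assume ?lhs
  then obtain Ks where "set Ks \<subseteq> K" "length Ks = n" "x = complex_field.combine Ks (map u [0..<n])"
    using complex_field.Span_mem_iff_length_version[OF assms, of "map u [0..<n]" x] by auto
  then show ?rhs
    by (intro exI[of _ "\<lambda>i. Ks ! i"]) (auto simp: combine_complex_field)
next
  assume ?rhs
  then obtain f where "\<forall>i<n. f i \<in> K" "x = (\<Sum>i<n. f i * u i)" by blast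
  then show ?lhs
    using complex_field.Span_mem_iff_length_version[OF assms, of "map u [0..<n]" x]
    by (auto intro!: exI[of _ "map f [0..<n]"] simp: combine_complex_field)
qed

lemma independent_complex_fieldI:
  assumes K: "complex_subfield K"
    and triv: "\<And>f i. (\<And>j. j < n \<Longrightarrow> f j \<in> K) \<Longrightarrow> (\<Sum>j<n. f j * u j) = 0 \<Longrightarrow> i < n \<Longrightarrow> f i = 0"
  shows "complex_field.independent K (map u [0..<n])"
proof (rule ccontr)
  assume "complex_field.dependent K (map u [0..<n])"
  then obtain Ks where Ks: "length Ks = n" "complex_field.combine Ks (map u [0..<n]) = 0"
      "set Ks \<subseteq> K" "set Ks \<noteq> {0}"
    using complex_field.dependent_imp_non_trivial_combine[OF K, of "map u [0..<n]"] by auto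
  have "Ks ! i = 0" if "i < n" for i
  proof (rule triv[of "\<lambda>i. Ks ! i"])
    show "Ks ! j \<in> K" if "j < n" for j using that Ks(1,3) by auto
    show "(\<Sum>j<n. Ks ! j * u j) = 0" using Ks(1,2) by (simp add: combine_complex_field)
  qed (rule that)
  then have "set Ks \<subseteq> {0}" using Ks(1) by (auto simp: in_set_conv_nth)
  then have "Ks = []" using Ks(4) by (cases Ks) auto
  then have "n = 0" using Ks by simp
  then have "complex_field.independent K (map u [0..<n])" by simp
  then show False using \<open>complex_field.dependent K (map u [0..<n])\<close> by simp
qed

lemma Span_complex_field_Cons:
  "complex_field.Span K (u # Us) = complex_field.line_extension K u (complex_field.Span K Us)"
  by (simp add: complex_field.Span.simps)

lemma Span_complex_field_closed:
  assumes K: "complex_subfield K"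
  shows Span_complex_field_0: "0 \<in> complex_field.Span K Us"
    and Span_complex_field_add:
      "x \<in> complex_field.Span K Us \<Longrightarrow> y \<in> complex_field.Span K Us \<Longrightarrow> x + y \<in> complex_field.Span K Us"
    and Span_complex_field_smult:
      "k \<in> K \<Longrightarrow> x \<in> complex_field.Span K Us \<Longrightarrow> k * x \<in> complex_field.Span K Us"
    and Span_complex_field_base: "x \<in> set Us \<Longrightarrow> x \<in> complex_field.Span K Us"
  using complex_field.Span_subgroup_props[OF K, of Us] complex_field.Span_smult_closed[OF K, of Us]
    complex_field.Span_base_incl[OF K, of Us]
  by auto

lemma Span_complex_field_sum:
  assumes K: "complex_subfield K"
  shows "(\<And>i. i \<in> A \<Longrightarrow> f i \<in> complex_field.Span K Us) \<Longrightarrow> sum f A \<in> complex_field.Span K Us"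
  by (induction A rule: infinite_finite_induct)
    (auto intro: Span_complex_field_0[OF K] Span_complex_field_add[OF K])

lemma Span_complex_field_subset:
  assumes K: "complex_subfield K" and L: "complex_subfield L" "K \<subseteq> L" "set Us \<subseteq> L"
  shows "complex_field.Span K Us \<subseteq> L"
  using L(3)
proof (induction Us)
  case Nil
  then show ?case using complex_subfield_0[OF L(1)] by (simp add: complex_field.Span.simps)
next
  case (Cons u Us)
  then show ?case using L complex_subfield_add[OF L(1)] complex_subfield_mult[OF L(1)]
    by (auto simp: Span_complex_field_Cons complex_field.line_extension_mem_iff) (meson subsetD)
qed

text \<open>The induction mirrors the definition of the span: a vector already in the span of the others
adds nothing, any other vector raises the dimension by one.\<close>

lemma dimension_Span_le_length:
  assumes K: "complex_subfield K"
  shows "\<exists>n\<le>length Us. complex_field.dimension n K (complex_field.Span K Us)"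
proof (induction Us)
  case Nil
  show ?case using complex_field.zero_dim[of K] by (auto simp: complex_field.Span.simps)
next
  case (Cons u Us)
  let ?S = "complex_field.Span K Us"
  obtain n where n: "n \<le> length Us" "complex_field.dimension n K ?S" using Cons.IH by blast
  have eq: "complex_field.Span K (u # Us) = complex_field.line_extension K u ?S"
    by (rule Span_complex_field_Cons)
  show ?case
  proof (cases "u \<in> ?S")
    case True
    then have "complex_field.line_extension K u ?S \<subseteq> ?S"
      by (auto simp: complex_field.line_extension_mem_iff
          intro!: Span_complex_field_add[OF K] Span_complex_field_smult[OF K])
    moreover have "?S \<subseteq> complex_field.line_extension K u ?S"
      using complex_field.mono_Span[OF K, of Us u] eq by simp
    ultimately have "complex_field.line_extension K u ?S = ?S" by (rule subset_antisym)
    then show ?thesis unfolding eq using n by (intro exI[of _ n]) simp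
  next
    case False
    then have "complex_field.dimension (Suc n) K (complex_field.line_extension K u ?S)"
      using n by (intro complex_field.Suc_dim) simp_all
    then show ?thesis unfolding eq using n by (intro exI[of _ "Suc n"]) simp
  qed
qed

lemma extension_degree_eqI:
  "complex_subfield K \<Longrightarrow> complex_field.dimension n K L \<Longrightarrow> extension_degree L K = n"
  using complex_field.dimI unfolding over_def by blast

text \<open>Dividing the exponent of \<open>\<zeta>\<^bsub>nr\<^esub>\<^sup>i\<close> by \<open>r\<close> with remainder splits off a power of \<open>\<zeta>\<^sub>n\<close>.\<close>

lemma cyclotomic_field_eq_Span:
  assumes n: "n > 0" and r: "r > 0"
  shows "cyclotomic_field (n * r) =
    complex_field.Span (cyclotomic_field n) (map (\<lambda>i. zeta (n * r) ^ i) [0..<r])" (is "?L = ?S")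
proof
  note M = cyclotomic_field_subfield[of n]
  show "?L \<subseteq> ?S"
  proof
    fix x assume "x \<in> ?L"
    then obtain h where h: "rational_poly h" "x = poly h (zeta (n * r))"
      using cyclotomic_field_eq_rational_polys[of "n * r"] n r by auto
    have "zeta (n * r) ^ i \<in> ?S" for i
    proof -
      have "zeta (n * r) ^ i = zeta (n * r) ^ (r * (i div r) + i mod r)" by simp
      also have "\<dots> = zeta n ^ (i div r) * zeta (n * r) ^ (i mod r)"
        unfolding power_add power_mult zeta_mult_power[OF r] ..
      also have "\<dots> \<in> ?S"
      proof (rule Span_complex_field_smult[OF M])
        show "zeta n ^ (i div r) \<in> cyclotomic_field n"
          by (intro complex_subfield_power[OF M] zeta_in_cyclotomic_field)
        show "zeta (n * r) ^ (i mod r) \<in> ?S"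
          using r by (intro Span_complex_field_base[OF M]) auto
      qed
      finally show ?thesis .
    qed
    moreover have "coeff h i \<in> cyclotomic_field n" for i
      using h Rats_subset_complex_subfield[OF M] by (auto simp: rational_poly_def)
    ultimately show "x \<in> ?S" unfolding h(2) poly_altdef
      by (intro Span_complex_field_sum[OF M] Span_complex_field_smult[OF M])
  qed
  show "?S \<subseteq> ?L"
    using r complex_subfield_power[OF cyclotomic_field_subfield zeta_in_cyclotomic_field]
    by (intro Span_complex_field_subset[OF M cyclotomic_field_subfield] cyclotomic_field_subset_mult) auto
qed

lemma cyclotomic_field_1: "cyclotomic_field 1 = \<rat>"
proof -
  have "zeta 1 = 1" using zeta_power_self[of 1] by simp
  then have "cyclotomic_field 1 \<subseteq> \<rat>" unfolding cyclotomic_field_altdef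
    by (intro rat_adjoin_subset[OF complex_subfield_Rats]) simp
  then show ?thesis using Rats_subset_complex_subfield[OF cyclotomic_field_subfield] by blast
qed

lemma cyclotomic_field_finite_dimension:
  assumes K: "complex_subfield K" and n: "n > 0" and sub: "K \<subseteq> cyclotomic_field n"
  shows "complex_field.finite_dimension K (cyclotomic_field n)"
proof -
  let ?Us = "map (\<lambda>i. zeta n ^ i) [0..<n]"
  have "complex_field.Span K ?Us \<subseteq> cyclotomic_field n"
    using complex_subfield_power[OF cyclotomic_field_subfield zeta_in_cyclotomic_field] sub
    by (intro Span_complex_field_subset[OF K cyclotomic_field_subfield]) auto
  moreover have "cyclotomic_field n \<subseteq> complex_field.Span K ?Us"
  proof
    fix x assume "x \<in> cyclotomic_field n"
    then have "x \<in> complex_field.Span \<rat> ?Us"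
      using cyclotomic_field_eq_Span[of 1 n] n by (simp add: cyclotomic_field_1 flip: One_nat_def)
    then show "x \<in> complex_field.Span K ?Us"
      unfolding mem_Span_complex_field_iff[OF K] mem_Span_complex_field_iff[OF complex_subfield_Rats]
      using Rats_subset_complex_subfield[OF K] by blast
  qed
  ultimately have "cyclotomic_field n = complex_field.Span K ?Us" by blast
  then show ?thesis using complex_field.Span_finite_dimension[OF K, of ?Us] by simp
qed

text \<open>The automorphism \<open>\<zeta>\<^bsub>nr\<^esub> \<mapsto> \<zeta>\<^bsub>nr\<^esub>\<^sup>j\<close> over \<open>\<rat>\<^sub>n\<close>, applied to a linear relation with
coefficients in \<open>\<rat>\<^sub>n\<close>. This is the form in which conjugation yields linear independence.\<close>

lemma conjugate_linear_relation:
  assumes n: "n > 0" and r: "r > 0" and j: "coprime j (n * r)" "j mod n = 1 mod n"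
    and m: "\<And>i. i < k \<Longrightarrow> m i \<in> cyclotomic_field n"
    and h: "\<And>i. i < k \<Longrightarrow> rational_poly (h i)"
    and rel: "(\<Sum>i<k. m i * poly (h i) (zeta (n * r))) = 0"
  shows "(\<Sum>i<k. m i * poly (h i) (zeta (n * r) ^ j)) = 0"
proof -
  have "\<exists>g. rational_poly g \<and> m i = poly g (zeta n)" if "i < k" for i
    using m[OF that] cyclotomic_field_eq_rational_polys[OF n] by blast
  then obtain g where g: "\<And>i. i < k \<Longrightarrow> rational_poly (g i)" "\<And>i. i < k \<Longrightarrow> m i = poly (g i) (zeta n)"
    by metis
  define H where "H = (\<Sum>i<k. pcompose (g i) (monom 1 r) * h i)"
  have H: "rational_poly H" unfolding H_def using g h
    by (intro rational_poly_sum rational_poly_mult rational_poly_pcompose rational_poly_monom) auto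
  have ev: "poly H z = (\<Sum>i<k. poly (g i) (z ^ r) * poly (h i) z)" for z
    by (simp add: H_def poly_sum poly_pcompose poly_monom)
  have "poly H (zeta (n * r)) = 0"
    using rel g by (simp add: ev zeta_mult_power[OF r])
  then have "poly H (zeta (n * r) ^ j) = 0"
    using n r by (intro rational_poly_root_of_unity_conjugate[OF _ _ j(1) H] zeta_power_self) auto
  moreover have "(zeta (n * r) ^ j) ^ r = zeta n"
  proof -
    have "(zeta (n * r) ^ j) ^ r = (zeta (n * r) ^ r) ^ j" by (simp only: power_mult[symmetric] mult.commute)
    also have "\<dots> = zeta n" using zeta_power_eq_iff[OF n, of j 1] j(2) by (simp add: zeta_mult_power[OF r])
    finally show ?thesis .
  qed
  ultimately show ?thesis using g by (simp add: ev)
qed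

lemma coeffs_zero_if_many_roots:
  fixes m :: "nat \<Rightarrow> complex"
  assumes "finite Y" "card Y \<ge> k" "\<And>y. y \<in> Y \<Longrightarrow> (\<Sum>i<k. m i * y ^ i) = 0" "i < k"
  shows "m i = 0"
proof (rule ccontr)
  assume nz: "m i \<noteq> 0"
  obtain k' where k': "k = Suc k'" using assms(4) by (cases k) auto
  have "finite {z. (\<Sum>i\<le>k'. m i * z ^ i) = 0}" "card {z. (\<Sum>i\<le>k'. m i * z ^ i) = 0} \<le> k'"
    using polyfun_rootbound[of m i k'] nz assms(4) k' by auto
  moreover have "Y \<subseteq> {z. (\<Sum>i\<le>k'. m i * z ^ i) = 0}"
    using assms(3) by (auto simp: k' lessThan_Suc_atMost)
  ultimately have "card Y \<le> k'" by (meson card_mono le_trans)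
  then show False using assms(2) k' by simp
qed

lemma coprime_same_radical:
  fixes n r :: nat
  assumes "r dvd n ^ k" "coprime j n"
  shows "coprime j (n * r)"
  using assms by (meson coprime_divisors coprime_mult_right_iff coprime_power_right_iff dvd_refl)

text \<open>A relation \<open>\<Sum>m\<^sub>i \<zeta>\<^sup>i = 0\<close> over \<open>\<rat>\<^sub>n\<close> with \<open>i < r\<close> and \<open>\<zeta> = \<zeta>\<^bsub>nr\<^esub>\<close> has the conjugates
\<open>\<Sum>m\<^sub>i \<zeta>\<^sup>i y\<^sup>i = 0\<close> for all \<open>r\<close>-th roots of unity \<open>y\<close>. That is too many roots for a
nonzero polynomial of degree below \<open>r\<close>.\<close>

lemma dimension_cyclotomic_field_over_smaller:
  assumes n: "n > 0" and r: "r > 0" "r dvd n ^ k"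
  shows "complex_field.dimension r (cyclotomic_field n) (cyclotomic_field (n * r))"
proof -
  let ?z = "zeta (n * r)" and ?M = "cyclotomic_field n"
  have "complex_field.independent ?M (map (\<lambda>i. ?z ^ i) [0..<r])"
  proof (rule independent_complex_fieldI[OF cyclotomic_field_subfield])
    fix f i assume f: "\<And>j. j < r \<Longrightarrow> f j \<in> ?M" "(\<Sum>j<r. f j * ?z ^ j) = 0" and i: "i < r"
    let ?Y = "(\<lambda>t. zeta r ^ t) ` {..<r}"
    have "card ?Y = r"
      using zeta_power_eq_iff[OF r(1)] by (subst card_image) (auto simp: inj_on_def)
    have "f i * ?z ^ i = 0"
    proof (rule coeffs_zero_if_many_roots[of ?Y r])
      fix y assume "y \<in> ?Y"
      then obtain t where t: "y = zeta r ^ t" by auto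
      define j where "j = 1 + n * t"
      have j: "coprime j (n * r)" "j mod n = 1 mod n"
        using coprime_same_radical[OF r(2)] coprime_1_plus_mult[of n t] mod_mult_self2[of 1 n t]
        unfolding j_def by blast+
      have "(\<Sum>i<r. f i * poly (monom 1 i) (?z ^ j)) = 0"
        by (rule conjugate_linear_relation[OF n r(1) j])
          (use f in \<open>auto simp: poly_monom intro: rational_poly_monom\<close>)
      moreover have "?z ^ j = ?z * y"
        using zeta_mult_power[OF n, of r] by (simp add: j_def t power_mult mult.commute)
      ultimately show "(\<Sum>i<r. f i * ?z ^ i * y ^ i) = 0"
        by (simp add: poly_monom power_mult_distrib mult.assoc)
    qed (use i \<open>card ?Y = r\<close> in auto)
    then show "f i = 0" by (simp add: zeta_def)
  qed
  then have "complex_field.dimension (length (map (\<lambda>i. ?z ^ i) [0..<r])) ?M (cyclotomic_field (n * r))"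
    using cyclotomic_field_eq_Span[OF n r(1)]
    by (intro complex_field.dimensionI[OF cyclotomic_field_subfield]) simp_all
  then show ?thesis by simp
qed

lemma dvd_extension_degree_of_subfield:
  assumes n: "n > 0" and r: "r > 0" "r dvd n ^ k" and K: "complex_subfield K" "K \<subseteq> cyclotomic_field n"
  shows "r dvd extension_degree (cyclotomic_field (n * r)) K"
proof -
  note dimr = dimension_cyclotomic_field_over_smaller[OF n r]
  have "extension_degree (cyclotomic_field (n * r)) K
      = extension_degree (cyclotomic_field n) K * extension_degree (cyclotomic_field (n * r)) (cyclotomic_field n)"
    using complex_field.telescopic_base_dim(2)[OF K(1) cyclotomic_field_subfield
      cyclotomic_field_finite_dimension[OF K(1) n K(2)] complex_field.finite_dimensionI[OF dimr]]
    unfolding over_def .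
  then show ?thesis using extension_degree_eqI[OF cyclotomic_field_subfield dimr] by simp
qed

section \<open>Elements outside the next smaller cyclotomic field\<close>

text \<open>Raising to the \<open>p\<close>-th power moves \<open>1 + p\<^sup>e v\<close> exactly one step down the filtration of the units
modulo powers of \<open>p\<close>. With \<open>u = 1 + p\<^sup>e v\<close>, the second factor of
\<open>u\<^sup>p - 1 = (u - 1)(1 + u + \<dots> + u\<^bsup>p-1\<^esup>)\<close> is congruent to \<open>p\<close> modulo \<open>p\<^sup>2\<close>. Oddness of \<open>p\<close> enters
because \<open>p\<close> has to divide \<open>0 + 1 + \<dots> + (p - 1)\<close>.\<close>

lemma one_plus_prime_power_pow:
  fixes v e :: nat
  assumes p: "Factorial_Ring.prime p" "odd p" and e: "e \<ge> 1" and v: "\<not> p dvd v"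
  obtains v' where "(1 + p ^ e * v) ^ p = 1 + p ^ (e + 1) * v'" "\<not> p dvd v'"
proof -
  define x where "x = int p ^ e * int v"
  define u where "u = 1 + x"
  have px: "int p dvd x" unfolding x_def using e by (cases e) auto
  then have px2: "int p ^ 2 dvd x ^ 2" by (simp add: dvd_power_same)
  \<comment> \<open>Binomial expansion to first order, as \<open>p\<^sup>2\<close> divides \<open>x\<^sup>2\<close>.\<close>
  have pow: "int p ^ 2 dvd u ^ i - (1 + int i * x)" for i
  proof (induction i)
    case (Suc i)
    have "u ^ Suc i - (1 + int (Suc i) * x) = u * (u ^ i - (1 + int i * x)) + int i * x ^ 2"
      by (simp add: u_def algebra_simps power2_eq_square)
    then show ?case using Suc px2 by simp
  qed simp
  define S where "S = (\<Sum>i<p. u ^ i)"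
  have "int p ^ 2 dvd (\<Sum>i<p. u ^ i - (1 + int i * x))" using pow by (intro dvd_sum) auto
  also have "(\<Sum>i<p. u ^ i - (1 + int i * x)) = S - int p - (\<Sum>i<p. int i) * x"
    by (simp add: S_def sum_subtractf sum.distrib sum_distrib_right)
  finally have d1: "int p ^ 2 dvd S - int p - (\<Sum>i<p. int i) * x" .
  have "int p dvd (\<Sum>i<p. int i)"
  proof -
    have "2 * (\<Sum>i<p. int i) = int p * (int p - 1)"
      by (induction p) (auto simp: algebra_simps)
    moreover have "coprime (int p) 2" using p(2) by simp
    ultimately show ?thesis by (metis coprime_dvd_mult_right_iff dvd_triv_left)
  qed
  then have d2: "int p ^ 2 dvd (\<Sum>i<p. int i) * x" using px by (simp add: power2_eq_square mult_dvd_mono)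
  have "int p ^ 2 dvd S - int p" using dvd_add[OF d1 d2] by simp
  then obtain y where y: "S - int p = int p ^ 2 * y" by (auto elim: dvdE)
  then have S: "S = int p * (1 + int p * y)" by (simp add: algebra_simps power2_eq_square)
  define z where "z = int v * (1 + int p * y)"
  have "u ^ p - 1 = (u - 1) * S" unfolding S_def by (rule power_diff_1_eq)
  then have up: "u ^ p = 1 + int p ^ (e + 1) * z" by (simp add: S z_def u_def x_def algebra_simps)
  have pz: "\<not> int p dvd z"
  proof
    assume "int p dvd z"
    moreover have "Factorial_Ring.prime (int p)" using p by simp
    moreover have "\<not> int p dvd 1 + int p * y"
      using prime_gt_1_nat[OF p(1)] by (metis dvd_add_left_iff dvd_triv_left int_dvd_int_iff nat_dvd_1_iff_1 of_nat_1 less_irrefl)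
    ultimately show False using v by (auto simp: z_def prime_dvd_mult_iff)
  qed
  have "u ^ p \<ge> 1" unfolding u_def x_def by (rule one_le_power) simp
  then have "int p ^ (e + 1) * z \<ge> 0" using up by simp
  moreover have "int p ^ (e + 1) > 0" using prime_gt_0_nat[OF p(1)] by simp
  ultimately have "z \<ge> 0" by (metis zero_le_mult_iff not_le)
  then have "int ((1 + p ^ e * v) ^ p) = int (1 + p ^ (e + 1) * nat z)"
    using up by (simp add: u_def x_def)
  then have "(1 + p ^ e * v) ^ p = 1 + p ^ (e + 1) * nat z" by (simp only: of_nat_eq_iff)
  moreover have "\<not> p dvd nat z" using pz \<open>z \<ge> 0\<close> by (metis int_dvd_int_iff nat_0_le)
  ultimately show ?thesis using that by blast
qed

lemma conjugate_fixed_power: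
  assumes N: "N > 0" and h: "rational_poly h" and u: "coprime u N"
    and fixed: "poly h (zeta N ^ u) = poly h (zeta N)"
  shows "poly h (zeta N ^ (u ^ t)) = poly h (zeta N)"
proof (induction t)
  case (Suc t)
  define H where "H = pcompose h (monom 1 u) - h"
  have ev: "poly H z = poly h (z ^ u) - poly h z" for z
    by (simp add: H_def poly_pcompose poly_monom)
  have "poly H (zeta N ^ (u ^ t)) = 0"
  proof (rule rational_poly_root_of_unity_conjugate[OF N zeta_power_self[OF N]])
    show "coprime (u ^ t) N" using u by simp
    show "rational_poly H" unfolding H_def using h
      by (intro rational_poly_diff rational_poly_pcompose rational_poly_monom) auto
    show "poly H (zeta N) = 0" using fixed by (simp add: ev)
  qed
  then show ?case using Suc by (simp add: ev power_mult[symmetric] mult.commute)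
qed simp

lemma zeta_power_cong: "n > 0 \<Longrightarrow> [i = j] (mod n) \<Longrightarrow> zeta n ^ i = zeta n ^ j"
  by (simp add: zeta_power_eq_iff cong_def)

text \<open>If the automorphism \<open>\<zeta> \<mapsto> \<zeta>\<^sup>u\<close> with \<open>u = 1 + p\<^sup>e v\<close> fixes an element, then so do all its powers.
Repeated \<open>p\<close>-th powers reach the case \<open>e = a - 1\<close>, where the powers of \<open>u\<close> are the
\<open>1 + p\<^bsup>a-1\<^esup>vt\<close> modulo \<open>p\<^sup>a\<close>, so the averaging argument applies.\<close>

lemma fixed_conjugate_in_smaller_field:
  assumes p: "Factorial_Ring.prime p" "odd p" and h: "rational_poly h"
    and e: "1 \<le> e" "e < a" and v: "\<not> p dvd v"
    and fixed: "poly h (zeta (p ^ a) ^ (1 + p ^ e * v)) = poly h (zeta (p ^ a))"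
  shows "poly h (zeta (p ^ a)) \<in> cyclotomic_field (p ^ (a - 1))"
  using e v fixed
proof (induction "a - e" arbitrary: e v)
  case 0
  then show ?case by simp
next
  case (Suc d)
  have p0: "p > 0" using prime_gt_0_nat[OF p(1)] .
  let ?u = "1 + p ^ e * v"
  have "coprime ?u (p ^ e)" by (rule coprime_1_plus_mult)
  then have "coprime ?u (p ^ a)" using Suc.prems by simp
  then have powers: "poly h (zeta (p ^ a) ^ (?u ^ t)) = poly h (zeta (p ^ a))" for t
    using p0 Suc.prems h by (intro conjugate_fixed_power) auto
  show ?case
  proof (cases "e = a - 1")
    case True
    have pa: "p ^ (a - 1) * p = p ^ a" using Suc.prems by (intro power_minus_mult) simp
    have "coprime v p" using prime_imp_coprime_nat[OF p(1) Suc.prems(3)] by (simp add: coprime_commute)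
    have cong: "[?u ^ t = 1 + p ^ (a - 1) * v * t] (mod p ^ a)" for t
    proof (induction t)
      case (Suc t)
      have "[?u ^ Suc t = ?u * (1 + p ^ (a - 1) * v * t)] (mod p ^ a)"
        using Suc by (simp only: power_Suc cong_mult cong_refl)
      also have "?u * (1 + p ^ (a - 1) * v * t) = (1 + p ^ (a - 1) * v * Suc t) + (p ^ e * p ^ (a - 1)) * (v * v * t)"
        by (simp add: True algebra_simps)
      also have "[\<dots> = (1 + p ^ (a - 1) * v * Suc t) + 0] (mod p ^ a)"
      proof -
        have "a \<le> e + (a - 1)" using Suc.prems \<open>1 \<le> e\<close> \<open>e < a\<close> by simp
        then have "p ^ a dvd p ^ e * p ^ (a - 1)" by (simp only: power_add[symmetric] le_imp_power_dvd)
        then show ?thesis by (intro cong_add cong_refl) (simp add: cong_0_iff)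
      qed
      finally show ?case by simp
    qed simp
    show ?thesis
    proof (rule fixed_by_conjugates_in_cyclotomic_field[OF _ p0 \<open>coprime v p\<close> h])
      fix t
      show "poly h (zeta (p ^ (a - 1) * p) ^ (1 + p ^ (a - 1) * v * t)) = poly h (zeta (p ^ a))"
        unfolding pa using powers[of t] zeta_power_cong[OF _ cong[of t]] p0 by simp
    qed (use p0 in simp)
  next
    case False
    obtain v' where v': "?u ^ p = 1 + p ^ (e + 1) * v'" "\<not> p dvd v'"
      using one_plus_prime_power_pow[OF p Suc.prems(1,3)] by metis
    show ?thesis
    proof (rule Suc.hyps(1)[of "e + 1" v'])
      show "poly h (zeta (p ^ a) ^ (1 + p ^ (e + 1) * v')) = poly h (zeta (p ^ a))"
        using powers[of p] v'(1) by simp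
    qed (use Suc False v' in auto)
  qed
qed

text \<open>If two conjugates under automorphisms over \<open>\<rat>\<^sub>p\<close> agreed, the quotient of the automorphisms would
be a nontrivial one, \<open>\<zeta> \<mapsto> \<zeta>\<^sup>u\<close> with \<open>u = 1 + p\<^sup>e v\<close>, that fixes the element itself.\<close>

lemma conjugates_distinct:
  assumes p: "Factorial_Ring.prime p" "odd p" and h: "rational_poly h" and a: "a \<ge> 1"
    and c: "poly h (zeta (p ^ a)) \<notin> cyclotomic_field (p ^ (a - 1))"
    and ij: "[i = 1] (mod p)" "[j = 1] (mod p)"
    and eq: "poly h (zeta (p ^ a) ^ i) = poly h (zeta (p ^ a) ^ j)"
  shows "[i = j] (mod p ^ a)"
proof (rule ccontr)
  assume neq: "\<not> [i = j] (mod p ^ a)"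
  have p0: "p > 0" and p1: "p > 1" using prime_gt_1_nat[OF p(1)] by auto
  let ?z = "zeta (p ^ a)"
  have cop: "coprime i (p ^ a)" "coprime j (p ^ a)"
    using ij a by (auto simp: coprime_power_right_iff dest!: cong_imp_coprime[OF cong_sym])
  \<comment> \<open>Both sides of the equality are moved by the inverse of \<open>\<zeta> \<mapsto> \<zeta>\<^sup>i\<close>.\<close>
  obtain i' where i': "[i * i' = 1] (mod p ^ a)" using cong_solve_coprime_nat[OF cop(1)] by auto
  have cop': "coprime i' (p ^ a)"
    using i' by (metis coprime_iff_invertible_nat mult.commute One_nat_def)
  define u where "u = j * i'"
  have pdvd: "p dvd p ^ a" using a by (simp add: dvd_power)
  have "[u = 1] (mod p)"
  proof -
    have "[i * i' = 1] (mod p)" using i' pdvd by (rule cong_dvd_modulus_nat)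
    moreover have "[i * i' = u] (mod p)" unfolding u_def
      using ij by (intro cong_mult cong_refl) (metis cong_sym cong_trans)
    ultimately show ?thesis by (metis cong_sym cong_trans)
  qed
  have un: "\<not> [u = 1] (mod p ^ a)"
  proof
    assume "[u = 1] (mod p ^ a)"
    then have "[j * i' = i * i'] (mod p ^ a)" using i' unfolding u_def by (metis cong_sym cong_trans)
    then have "[j = i] (mod p ^ a)" using cop' by (simp add: cong_mult_rcancel_nat coprime_commute)
    then show False using neq cong_sym by blast
  qed
  have "coprime u (p ^ a)" using cop(2) cop' by (simp only: u_def coprime_mult_left_iff)
  then have "u \<noteq> 0" using p1 a by (cases "u = 0") auto
  moreover have "u \<noteq> 1" using un by auto
  ultimately have u1: "u - 1 \<noteq> 0" by simp
  obtain v where v: "u - 1 = p ^ multiplicity p (u - 1) * v" "\<not> p dvd v"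
    using multiplicity_decompose'[OF u1, of p] p1 by (metis nat_dvd_1_iff_1 less_irrefl)
  define e where "e = multiplicity p (u - 1)"
  have u: "u = 1 + p ^ e * v" using v(1) u1 by (simp add: e_def)
  have "e \<ge> 1"
  proof (rule ccontr)
    assume "\<not> e \<ge> 1"
    then have "u = 1 + v" using u by simp
    then have "p dvd v" using \<open>[u = 1] (mod p)\<close> by (simp add: cong_altdef_nat)
    then show False using v by simp
  qed
  moreover have "e < a"
  proof (rule ccontr)
    assume "\<not> e < a"
    then have "p ^ a dvd p ^ e * v" by (simp add: le_imp_power_dvd)
    then show False using un u by (simp add: cong_altdef_nat)
  qed
  moreover have "poly h (?z ^ u) = poly h ?z"
  proof -
    define H where "H = pcompose h (monom 1 i) - pcompose h (monom 1 j)"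
    have ev: "poly H x = poly h (x ^ i) - poly h (x ^ j)" for x
      by (simp add: H_def poly_pcompose poly_monom)
    have "poly H (?z ^ i') = 0"
    proof (rule rational_poly_root_of_unity_conjugate[OF _ zeta_power_self cop'])
      show "rational_poly H" unfolding H_def using h
        by (intro rational_poly_diff rational_poly_pcompose rational_poly_monom) auto
    qed (use p0 eq ev in auto)
    then have "poly h (?z ^ u) = poly h (?z ^ (i * i'))"
      by (simp add: ev u_def power_mult[symmetric] mult.commute)
    also have "?z ^ (i * i') = ?z" using zeta_power_cong[OF _ i'] p0 by simp
    finally show ?thesis .
  qed
  ultimately have "poly h ?z \<in> cyclotomic_field (p ^ (a - 1))"
    using v(2) fixed_conjugate_in_smaller_field[OF p h, of e a v] unfolding u by simp
  then show False using c by simp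
qed

text \<open>Since \<open>1 + \<zeta>\<^sub>p + \<dots> + \<zeta>\<^sub>p\<^bsup>p-1\<^esup> = 0\<close>, the power \<open>\<zeta>\<^sub>p\<^bsup>p-1\<^esup>\<close> can be omitted from the spanning set. This is
what pushes the degree in \<open>not_dvd_extension_degree\<close> strictly below \<open>p\<close>.\<close>

lemma zeta_prime_power_in_Span:
  assumes K: "complex_subfield K" and p: "p > 1"
  shows "zeta p ^ i \<in> complex_field.Span K (map (\<lambda>i. zeta p ^ i) [0..<p - 1])" (is "_ \<in> ?S")
proof -
  have base: "zeta p ^ i \<in> ?S" if "i < p - 1" for i
    using that by (intro Span_complex_field_base[OF K]) auto
  have "zeta p \<noteq> 1" using zeta_power_eq_1_iff[of p 1] p by auto
  then have "(\<Sum>i<p. zeta p ^ i) = 0" using zeta_power_self[of p] p by (simp add: geometric_sum)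
  moreover have "(\<Sum>i<p. zeta p ^ i) = (\<Sum>i<p - 1. zeta p ^ i) + zeta p ^ (p - 1)"
    using p by (cases p) auto
  ultimately have "zeta p ^ (p - 1) = (- 1) * (\<Sum>i<p - 1. zeta p ^ i)"
    by (simp add: add_eq_0_iff)
  also have "\<dots> \<in> ?S"
    using base complex_subfield_uminus[OF K complex_subfield_1[OF K]]
    by (intro Span_complex_field_smult[OF K] Span_complex_field_sum[OF K]) auto
  finally have "zeta p ^ i \<in> ?S" if "i \<le> p - 1" for i
    using that base by (cases "i = p - 1") auto
  moreover have "zeta p ^ i = zeta p ^ (i mod p)"
    using zeta_power_eq_iff[of p i "i mod p"] p by simp
  moreover have "i mod p \<le> p - 1" using mod_less_divisor[of p i] p by linarith
  ultimately show ?thesis by metis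
qed

text \<open>A polynomial over \<open>\<rat>\<^sub>p\<close> that vanishes at \<open>c\<close> vanishes at its \<open>p\<^bsup>a-1\<^esup>\<close> distinct conjugates.
Hence the first \<open>p\<^bsup>a-1\<^esup>\<close> powers of \<open>c\<close> are independent over \<open>\<rat>\<^sub>p\<close>, and their number equals the
dimension.\<close>

lemma cyclotomic_field_eq_Span_of_primitive_element:
  assumes p: "Factorial_Ring.prime p" "odd p" and a: "a \<ge> 1"
    and c: "c \<in> cyclotomic_field (p ^ a)" "c \<notin> cyclotomic_field (p ^ (a - 1))"
  shows "complex_field.Span (cyclotomic_field p) (map (\<lambda>i. c ^ i) [0..<p ^ (a - 1)]) = cyclotomic_field (p ^ a)"
proof -
  have p0: "p > 0" using prime_gt_0_nat[OF p(1)] .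
  let ?N = "p ^ (a - 1)" and ?z = "zeta (p ^ a)" and ?F = "cyclotomic_field p"
  have pa: "p * ?N = p ^ a" using a by (metis power_eq_if not_one_le_zero)
  obtain h where h: "rational_poly h" "c = poly h ?z"
    using c(1) cyclotomic_field_eq_rational_polys[of "p ^ a"] p0 by auto
  have indep: "complex_field.independent ?F (map (\<lambda>i. c ^ i) [0..<?N])"
  proof (rule independent_complex_fieldI[OF cyclotomic_field_subfield])
    fix f i assume f: "\<And>j. j < ?N \<Longrightarrow> f j \<in> ?F" "(\<Sum>j<?N. f j * c ^ j) = 0" and i: "i < ?N"
    let ?conj = "\<lambda>s. poly h (?z ^ (1 + p * s))"
    have inj: "inj_on ?conj {..<?N}"
    proof (rule inj_onI)
      fix s t assume st: "s \<in> {..<?N}" "t \<in> {..<?N}" "?conj s = ?conj t"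
      have "[1 + p * s = 1 + p * t] (mod p ^ a)"
      proof (rule conjugates_distinct[OF p h(1) a _ _ _ st(3)])
        show "poly h ?z \<notin> cyclotomic_field (p ^ (a - 1))" using c h by simp
      qed (simp_all only: cong_def mod_mult_self2)
      then have "[p * s = p * t] (mod p * ?N)" unfolding pa by (simp only: cong_add_lcancel_nat)
      moreover have "p * s < p * ?N" "p * t < p * ?N" using st p0 by auto
      ultimately have "p * s = p * t" by (metis cong_def mod_less)
      then show "s = t" using p0 by simp
    qed
    show "f i = 0"
    proof (rule coeffs_zero_if_many_roots[OF _ _ _ i])
      show "finite (?conj ` {..<?N})" by simp
      show "?N \<le> card (?conj ` {..<?N})" using inj by (simp add: card_image)
      fix y assume "y \<in> ?conj ` {..<?N}"
      then obtain s where s: "y = poly h (zeta (p * ?N) ^ (1 + p * s))" unfolding pa by blast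
      have "(\<Sum>i<?N. f i * poly (h ^ i) (zeta (p * ?N) ^ (1 + p * s))) = 0"
      proof (rule conjugate_linear_relation)
        show "coprime (1 + p * s) (p * ?N)"
          by (rule coprime_same_radical[OF dvd_refl coprime_1_plus_mult])
        show "(1 + p * s) mod p = 1 mod p" by (rule mod_mult_self2)
        show "(\<Sum>i<?N. f i * poly (h ^ i) (zeta (p * ?N))) = 0" using f h unfolding pa by simp
        show "p > 0" "?N > 0" using p0 by simp_all
        show "f i \<in> ?F" if "i < ?N" for i using f(1)[OF that] .
        show "rational_poly (h ^ i)" for i using h(1) by (rule rational_poly_power)
      qed
      then show "(\<Sum>i<?N. f i * y ^ i) = 0" by (simp only: s poly_power)
    qed
  qed
  have "complex_field.dimension ?N ?F (cyclotomic_field (p ^ a))"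
    using dimension_cyclotomic_field_over_smaller[of p ?N "a - 1"] p0 pa by simp
  then have "length (map (\<lambda>i. c ^ i) [0..<?N]) = ?N \<longleftrightarrow>
      complex_field.Span ?F (map (\<lambda>i. c ^ i) [0..<?N]) = cyclotomic_field (p ^ a)"
    using indep complex_subfield_power[OF cyclotomic_field_subfield c(1)]
    by (intro complex_field.independent_length_eq_dimension[OF cyclotomic_field_subfield]) auto
  then show ?thesis by simp
qed

text \<open>By the previous lemma \<open>\<rat>\<^bsub>p^a\<^esub> = \<rat>(c)(\<zeta>\<^sub>p)\<close>, which has degree at most \<open>p - 1\<close> over \<open>\<rat>(c)\<close>.\<close>

lemma not_dvd_extension_degree:
  assumes p: "Factorial_Ring.prime p" "odd p" and a: "a \<ge> 1"
    and c: "c \<in> cyclotomic_field (p ^ a)" "c \<notin> cyclotomic_field (p ^ (a - 1))"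
  shows "\<not> p dvd extension_degree (cyclotomic_field (p ^ a)) (rat_adjoin {c})"
proof -
  have p0: "p > 0" and p1: "p > 1" using prime_gt_1_nat[OF p(1)] by auto
  let ?K = "rat_adjoin {c}" and ?L = "cyclotomic_field (p ^ a)" and ?N = "p ^ (a - 1)"
  let ?Us = "map (\<lambda>i. zeta p ^ i) [0..<p - 1]"
  note K = complex_subfield_rat_adjoin[of "{c}"]
  note L = cyclotomic_field_subfield[of "p ^ a"]
  have cK: "c \<in> ?K" using subset_rat_adjoin by blast
  have FL: "cyclotomic_field p \<subseteq> ?L" using a p0 by (intro cyclotomic_field_mono) (auto simp: dvd_power)
  have "complex_field.Span ?K ?Us \<subseteq> ?L"
  proof (rule Span_complex_field_subset[OF K L])
    show "?K \<subseteq> ?L" using c by (intro rat_adjoin_subset[OF L]) simp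
    show "set ?Us \<subseteq> ?L" using FL complex_subfield_power[OF cyclotomic_field_subfield zeta_in_cyclotomic_field] by auto
  qed
  moreover have "?L \<subseteq> complex_field.Span ?K ?Us"
  proof
    fix x assume "x \<in> ?L"
    then obtain f where f: "\<forall>i<?N. f i \<in> cyclotomic_field p" "x = (\<Sum>i<?N. f i * c ^ i)"
      using cyclotomic_field_eq_Span_of_primitive_element[OF p a c]
        mem_Span_complex_field_iff[OF cyclotomic_field_subfield[of p], of x "\<lambda>i. c ^ i" ?N] by auto
    have "y \<in> complex_field.Span ?K ?Us" if y: "y \<in> cyclotomic_field p" for y
    proof -
      obtain h where h: "rational_poly h" "y = poly h (zeta p)"
        using y unfolding cyclotomic_field_eq_rational_polys[OF p0] by blast
      then show ?thesis unfolding h(2) poly_altdef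
        using zeta_prime_power_in_Span[OF K p1] Rats_subset_complex_subfield[OF K]
        by (intro Span_complex_field_sum[OF K] Span_complex_field_smult[OF K]) (auto simp: rational_poly_def)
    qed
    then have "(\<Sum>i<?N. c ^ i * f i) \<in> complex_field.Span ?K ?Us"
      using f complex_subfield_power[OF K cK]
      by (intro Span_complex_field_sum[OF K] Span_complex_field_smult[OF K]) auto
    then show "x \<in> complex_field.Span ?K ?Us" using f(2) by (simp add: mult.commute)
  qed
  ultimately have LS: "complex_field.Span ?K ?Us = ?L" by blast
  obtain n where n: "n \<le> p - 1" "complex_field.dimension n ?K ?L"
    using dimension_Span_le_length[OF K, of ?Us] unfolding LS by auto
  have "n \<noteq> 0"
  proof
    assume "n = 0"
    then have "?L = {0}" using complex_field.dimension_zero[OF K] n by simp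
    then show False using complex_subfield_1[OF L] by simp
  qed
  then have "\<not> p dvd n" using n(1) p1 by (auto dest: dvd_imp_le)
  then show ?thesis using extension_degree_eqI[OF K n(2)] by simp
qed

section \<open>Character values of elements of finite order\<close>

lemma mat_trace_mult_commute:
  assumes "A \<in> carrier_mat n m" "B \<in> carrier_mat m n"
  shows "mat_trace (A * B) = mat_trace (B * A)"
proof -
  have "mat_trace (A * B) = (\<Sum>i<n. \<Sum>j<m. A $$ (i, j) * B $$ (j, i))"
    using assms by (auto simp: mat_trace_def scalar_prod_def lessThan_atLeast0 intro!: sum.cong)
  also have "\<dots> = (\<Sum>j<m. \<Sum>i<n. B $$ (j, i) * A $$ (i, j))"
    by (subst sum.swap) (simp add: mult.commute)
  also have "\<dots> = mat_trace (B * A)"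
    using assms by (auto simp: mat_trace_def scalar_prod_def lessThan_atLeast0 intro!: sum.cong)
  finally show ?thesis .
qed

text \<open>By the Schur decomposition the matrix is similar to a triangular one with the roots of the
characteristic polynomial on its diagonal.\<close>

lemma mat_trace_eq_sum_roots:
  assumes A: "A \<in> carrier_mat n n" and es: "char_poly A = (\<Prod>e\<leftarrow>es. [:- e, 1:])"
  shows "mat_trace A = sum_list es"
proof -
  obtain B P Q where BPQ: "schur_decomposition A es = (B, P, Q)" by (metis prod_cases3)
  note schur = schur_decomposition[OF A es BPQ]
  then have wit: "similar_mat_wit A B P Q" and diag: "diag_mat B = es" by auto
  note sim = similar_mat_witD2[OF A wit]
  have "mat_trace A = mat_trace (P * (B * Q))" using sim by (simp add: assoc_mult_mat[of P n n B n Q n])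
  also have "\<dots> = mat_trace (B * Q * P)"
    using sim by (intro mat_trace_mult_commute[of _ n n]) auto
  also have "B * Q * P = B" using sim by (simp add: assoc_mult_mat[of B n n Q n P n])
  also have "mat_trace B = sum_list (diag_mat B)"
    by (simp add: mat_trace_def diag_mat_def interv_sum_list_conv_sum_set_nat lessThan_atLeast0)
  finally show ?thesis using diag by simp
qed

text \<open>All eigenvalues of a matrix with \<open>A\<^sup>N = 1\<close> are \<open>N\<close>-th roots of unity.\<close>

lemma mat_trace_in_cyclotomic_field:
  assumes A: "A \<in> carrier_mat n n" and N: "N > 0" and pow: "A ^\<^sub>m N = 1\<^sub>m n"
  shows "mat_trace A \<in> cyclotomic_field N"
proof -
  obtain es where es: "char_poly A = (\<Prod>e\<leftarrow>es. [:- e, 1:])"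
    using char_poly_factorized[OF A] by blast
  have "e \<in> cyclotomic_field N" if e: "e \<in> set es" for e
  proof -
    have "poly (char_poly A) e = 0" unfolding es using e by (induction es) auto
    then obtain v where v: "eigenvector A v e"
      using eigenvalue_root_char_poly[OF A] unfolding eigenvalue_def by blast
    then have vn: "v \<in> carrier_vec n" "v \<noteq> 0\<^sub>v n" using A by (auto simp: eigenvector_def)
    have ev: "v = e ^ N \<cdot>\<^sub>v v" using eigenvector_pow[OF A v, of N] vn by (simp add: pow)
    obtain i where i: "i < n" "vec_index v i \<noteq> 0" using vn by (metis eq_vecI index_zero_vec carrier_vecD)
    have "vec_index v i = e ^ N * vec_index v i" using arg_cong[OF ev, of "\<lambda>v. vec_index v i"] i vn by simp
    then have "e ^ N = 1" using i by simp
    then obtain k where "e = cis (2 * pi * real k / real N)"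
      using bij_betw_roots_unity[OF N] unfolding bij_betw_def by blast
    then have "e = zeta N ^ k" by (simp add: zeta_def DeMoivre mult_ac)
    then show ?thesis
      by (simp add: complex_subfield_power[OF cyclotomic_field_subfield zeta_in_cyclotomic_field])
  qed
  then have "sum_list es \<in> cyclotomic_field N"
    by (induction es) (auto intro: complex_subfield_0[OF cyclotomic_field_subfield]
        complex_subfield_add[OF cyclotomic_field_subfield])
  then show ?thesis using mat_trace_eq_sum_roots[OF A es] by simp
qed

lemma representation_nat_pow:
  assumes G: "group G" and \<rho>: "representation G n \<rho>" and g: "g \<in> carrier G"
  shows "\<rho> (g [^]\<^bsub>G\<^esub> (k :: nat)) = \<rho> g ^\<^sub>m k"
proof -
  interpret G: group G by (rule G)
  let ?R = "ring_mat TYPE(complex) n ()"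
  interpret R: ring ?R by (rule ring_mat)
  have hom: "\<rho> \<in> hom G (units_of ?R)" using \<rho> by (simp add: representation_def)
  have carr: "\<rho> x \<in> carrier_mat n n" if "x \<in> carrier G" for x
    using hom_in_carrier[OF hom that] R.Units_closed by (simp add: units_of_carrier ring_mat_simps)
  show ?thesis
  proof (induction k)
    case 0
    have "\<rho> \<one>\<^bsub>G\<^esub> = 1\<^sub>m n"
      using hom_one[OF hom G R.units_group] by (simp add: units_of_one ring_mat_simps)
    then show ?case using carr[OF g] by simp
  next
    case (Suc k)
    have "\<rho> (g [^]\<^bsub>G\<^esub> k \<otimes>\<^bsub>G\<^esub> g) = \<rho> (g [^]\<^bsub>G\<^esub> k) * \<rho> g"
      using hom_mult[OF hom, of "g [^]\<^bsub>G\<^esub> k" g] g by (simp add: units_of_mult ring_mat_simps)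
    then show ?case using Suc by simp
  qed
qed

lemma irreducible_character_value_in_cyclotomic_field:
  assumes G: "group G" and fin: "finite (carrier G)"
    and \<chi>: "\<chi> \<in> irreducible_characters G" and g: "g \<in> carrier G"
  shows "\<chi> g \<in> cyclotomic_field (group.ord G g)"
proof -
  interpret G: group G by (rule G)
  obtain n \<rho> where \<rho>: "irreducible_representation G n \<rho>"
      "\<chi> = restrict (\<lambda>g. mat_trace (\<rho> g)) (carrier G)"
    using \<chi> by (auto simp: irreducible_characters_def)
  then have rep: "representation G n \<rho>" by (simp add: irreducible_representation_def)
  interpret R: ring "ring_mat TYPE(complex) n ()" by (rule ring_mat)
  have A: "\<rho> g \<in> carrier_mat n n"
    using hom_in_carrier[OF rep[unfolded representation_def] g] R.Units_closed
    by (simp add: units_of_carrier ring_mat_simps)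
  have "\<rho> (g [^]\<^bsub>G\<^esub> (0 :: nat)) = 1\<^sub>m n" using representation_nat_pow[OF G rep g, of 0] A by simp
  then have "\<rho> g ^\<^sub>m G.ord g = 1\<^sub>m n"
    using representation_nat_pow[OF G rep g, of "G.ord g"] g by simp
  then show ?thesis
    using mat_trace_in_cyclotomic_field[OF A] G.ord_ge_1[OF fin g] \<rho>(2) g by simp
qed

section \<open>Conductors and degrees\<close>

text \<open>The conductor behaves as intended as soon as some cyclotomic field contains \<open>K\<close>.\<close>

lemma conductor_props:
  assumes "0 < n" "K \<subseteq> cyclotomic_field n"
  shows conductor_pos: "0 < conductor K"
    and subset_cyclotomic_field_conductor: "K \<subseteq> cyclotomic_field (conductor K)"
    and conductor_le: "conductor K \<le> n"
proof -
  have "0 < conductor K \<and> K \<subseteq> cyclotomic_field (conductor K)"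
    unfolding conductor_def by (rule LeastI[of _ n]) (use assms in simp)
  then show "0 < conductor K" "K \<subseteq> cyclotomic_field (conductor K)" by auto
  show "conductor K \<le> n" unfolding conductor_def by (rule Least_le) (use assms in simp)
qed

lemma rat_adjoin_single_subset_iff: "rat_adjoin {c} \<subseteq> cyclotomic_field n \<longleftrightarrow> c \<in> cyclotomic_field n"
  using rat_adjoin_subset[OF cyclotomic_field_subfield, of "{c}"] subset_rat_adjoin[of "{c}"] by auto

lemma p_part_decompose:
  assumes "Factorial_Ring.prime p" "n > 0"
  obtains a m where "n = p ^ a * m" "\<not> p dvd m" "p_part p n = p ^ a"
  using multiplicity_decompose'[of n p] assms by (metis p_part_def not_prime_unit not_gr0)

lemma p_part_mult_power:
  assumes p: "Factorial_Ring.prime p" and m: "\<not> p dvd m"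
  shows "p_part p (p ^ a * m) = p ^ a"
  using p m unfolding p_part_def
  by (subst prime_elem_multiplicity_mult_distrib) (auto simp: not_dvd_imp_multiplicity_0 intro: gr0I)

text \<open>Let \<open>p\<^sup>bm\<close> be the conductor of \<open>c\<close>. It is at most \<open>p\<^sup>a\<close>, so \<open>b \<le> a\<close>. If \<open>b < a\<close>, then \<open>c\<close> lies in
\<open>\<rat>\<^bsub>p^(a-1)m\<^esub> \<inter> \<rat>\<^bsub>p^a\<^esub>\<close>, which is contained in \<open>\<rat>\<^bsub>p^(a-1)\<^esub>\<close> as \<open>a - 1 \<ge> 1\<close>. Conversely, an
element of \<open>\<rat>\<^bsub>p^(a-1)\<^esub>\<close> has conductor at most \<open>p\<^bsup>a-1\<^esup>\<close>.\<close>

lemma p_part_number_conductor_iff: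
  assumes p: "Factorial_Ring.prime p" and a: "a \<ge> 2" and c: "c \<in> cyclotomic_field (p ^ a)"
  shows "p_part p (number_conductor c) = p ^ a \<longleftrightarrow> c \<notin> cyclotomic_field (p ^ (a - 1))"
proof -
  have p0: "p > 0" and p1: "p > 1" using prime_gt_1_nat[OF p] by auto
  have leI: "number_conductor c \<le> n" if "c \<in> cyclotomic_field n" "n > 0" for n
    unfolding number_conductor_def using conductor_le[of n "rat_adjoin {c}"] that
    by (simp add: rat_adjoin_single_subset_iff)
  have f: "number_conductor c > 0" "c \<in> cyclotomic_field (number_conductor c)"
    unfolding number_conductor_def using conductor_props[of "p ^ a" "rat_adjoin {c}"] c p0
    by (simp_all add: rat_adjoin_single_subset_iff)
  obtain b m where bm: "number_conductor c = p ^ b * m" "\<not> p dvd m"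
      "p_part p (number_conductor c) = p ^ b"
    using p_part_decompose[OF p f(1)] .
  have m0: "m > 0" using bm by (auto intro: gr0I)
  have "p ^ b \<le> number_conductor c" using bm(1) m0 by simp
  then have le: "p ^ b \<le> n" if "c \<in> cyclotomic_field n" "n > 0" for n using leI[OF that] by simp
  have "b \<le> a" using le[OF c] p0 p1 by simp
  have "b \<noteq> a" if "c \<in> cyclotomic_field (p ^ (a - 1))"
    using le[OF that] p0 p1 a by auto
  moreover have "c \<in> cyclotomic_field (p ^ (a - 1))" if "b \<noteq> a"
  proof -
    have "number_conductor c dvd p ^ (a - 1) * m"
      unfolding bm(1) using \<open>b \<le> a\<close> that by (intro mult_dvd_mono le_imp_power_dvd) auto
    then have "c \<in> cyclotomic_field (p ^ (a - 1) * m)"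
      using f(2) cyclotomic_field_mono m0 p0 by (metis nat_0_less_mult_iff subsetD zero_less_power)
    moreover have "1 \<le> a - 1" using a by simp
    ultimately show ?thesis
      using cyclotomic_field_prime_power_inter[OF p, of "a - 1" m a] m0 bm(2) c by auto
  qed
  ultimately show ?thesis unfolding bm(3) using p1 by (metis power_inject_exp)
qed

lemma dvd_extension_degree_iff:
  assumes p: "Factorial_Ring.prime p" "odd p" and a: "a \<ge> 2" and c: "c \<in> cyclotomic_field (p ^ a)"
  shows "p dvd extension_degree (cyclotomic_field (p ^ a)) (rat_adjoin {c})
    \<longleftrightarrow> c \<in> cyclotomic_field (p ^ (a - 1))"
proof
  assume "c \<in> cyclotomic_field (p ^ (a - 1))"
  moreover have "p dvd (p ^ (a - 1)) ^ 1" using a by simp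
  moreover have "p ^ (a - 1) * p = p ^ a" using a by (intro power_minus_mult) simp
  ultimately show "p dvd extension_degree (cyclotomic_field (p ^ a)) (rat_adjoin {c})"
    using dvd_extension_degree_of_subfield[of "p ^ (a - 1)" p 1 "rat_adjoin {c}"]
      complex_subfield_rat_adjoin prime_gt_0_nat[OF p(1)]
    by (simp add: rat_adjoin_single_subset_iff)
qed (use not_dvd_extension_degree[OF p _ c] a in auto)

theorem corollary2p6:
  fixes G :: "('a, 'b) monoid_scheme" and p d :: nat and \<chi> :: "'a \<Rightarrow> complex"
  assumes "group G" and "finite (carrier G)"
    and "Factorial_Ring.prime p" and "odd p"
    and "\<chi> \<in> irreducible_characters G"
    and "\<chi> \<one>\<^bsub>G\<^esub> = of_nat d" and "\<not> p dvd d"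
    and "p_part p (character_conductor G \<chi>) \<ge> p ^ 2"
  shows "property_1_3 G p \<chi> \<longleftrightarrow>
    (\<exists>g. p_element G p g \<and>
      p_part p (character_conductor G \<chi>) = p_part p (number_conductor (\<chi> g)))"
proof -
  interpret G: group G by fact
  note p = assms(3,4)
  have p0: "p > 0" and p1: "p > 1" using prime_gt_1_nat[OF p(1)] by auto
  let ?f = "character_conductor G \<chi>"
  have val: "\<chi> g \<in> cyclotomic_field (G.ord g)" if "g \<in> carrier G" for g
    using irreducible_character_value_in_cyclotomic_field[OF assms(1,2,5) that] .
  have n0: "Coset.order G > 0" using assms(2) G.order_gt_0_iff_finite by simp
  have "\<chi> ` carrier G \<subseteq> cyclotomic_field (Coset.order G)"
    using val G.ord_dvd_group_order cyclotomic_field_mono[OF _ n0] by blast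
  then have "character_field G \<chi> \<subseteq> cyclotomic_field (Coset.order G)"
    unfolding character_field_def by (rule rat_adjoin_subset[OF cyclotomic_field_subfield])
  then have f: "?f > 0" "character_field G \<chi> \<subseteq> cyclotomic_field ?f"
    unfolding character_conductor_def using conductor_props[OF n0] by auto
  obtain a m where am: "?f = p ^ a * m" "\<not> p dvd m" "p_part p ?f = p ^ a"
    using p_part_decompose[OF p(1) f(1)] .
  have m0: "m > 0" using am by (auto intro: gr0I)
  have a: "a \<ge> 2" using assms(8) p1 unfolding am(3) by simp
  have value_in: "\<chi> g \<in> cyclotomic_field (p ^ a)" if g: "p_element G p g" for g
  proof -
    obtain k where k: "g \<in> carrier G" "G.ord g = p ^ k" using g by (auto simp: p_element_def)
    have "\<chi> g \<in> character_field G \<chi>"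
      unfolding character_field_def using k subset_rat_adjoin by blast
    then have "\<chi> g \<in> cyclotomic_field (p ^ a * m)" using f(2) am(1) by auto
    moreover have "\<chi> g \<in> cyclotomic_field (p ^ k)" using val k by metis
    ultimately show ?thesis
      using cyclotomic_field_prime_power_inter[OF p(1), of a m k] m0 am(2) a by auto
  qed
  have unique: "p ^ b = p ^ a" if "?f = p ^ b * l" "\<not> p dvd l" for b l
    using that p_part_mult_power[OF p(1) that(2), of b] am(3) by simp
  have "property_1_3 G p \<chi> \<longleftrightarrow> (\<exists>g. p_element G p g \<and>
      \<not> p dvd extension_degree (cyclotomic_field (p ^ a)) (rat_adjoin {\<chi> g}))"
    unfolding property_1_3_def using am(1,2) unique by metis
  also have "\<dots> \<longleftrightarrow> (\<exists>g. p_element G p g \<and> p_part p (number_conductor (\<chi> g)) = p ^ a)"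
    using value_in dvd_extension_degree_iff[OF p a] p_part_number_conductor_iff[OF p(1) a] by blast
  finally show ?thesis unfolding am(3) by (simp add: eq_commute)
qed

end
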